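(* There is a universal constant $C>0$ such that the following holds. Let $s_0>2$ and let $u$ be a $C^2$ function defined in $\mathcal K_{[2,s_0]}$, vanishing near the conical boundary $\partial\mathcal K=\{t=r+1\}$, and satisfying $$ \Box u=F\ \text{ in }\mathcal K_{[2,s_0]},\qquad u|_{\mathcal H_2}=u_0,\quad \partial_t u|_{\mathcal H_2}=u_1, $$ with $u_0,u_1$ being $C_c^\infty$ and supported in $\mathcal H_2\cap\mathcal K$. Suppose that $F$ is defined in $\mathcal K_{[2,s_0]}$, vanishes near $\partial\mathcal K$, and satisfies, for some constant $C_F$, $$ |F(t,x)|\le C_F\,t^{-2}\quad\text{in }\mathcal K_{[2,s_0]} . $$ Then, with $s=\sqrt{t^2-|x|^2}$, $$ |u(t,x)|\le C\,C_F\,(s/t)+C_0\,s^{-1}\qquad\text{for all }(t,x)\in\mathcal K_{[2,s_0]}, $$ where $C_0$ is a constant determined by $u_0$ and $u_1$.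
   Context: Space-time is $\mathbb{R}^{1+2}$ with coordinates $(t,x)$, $r=|x|$. $\Box=\partial_t^2-\partial_1^2-\partial_2^2$. $\mathcal K=\{(t,x): t>r+1\}$, $\mathcal H_s=\{(t,x): t=\sqrt{s^2+r^2}\}$, $\mathcal K_{[2,s_0]}=\{(t,x)\in\mathcal K:\sqrt{4+r^2}\le t\le\sqrt{s_0^2+r^2}\}$. "Vanishes near $\partial\mathcal K$" means vanishing in a neighbourhood of $\{t=r+1\}$. *)

theory Defs
  imports "HOL-Analysis.Analysis"
begin

type_synonym spacetime = "real \<times> (real ^ 2)"

text \<open>
  Derivatives on a set that need not be open are taken within that set.  The library's
  \<^const>\<open>frechet_derivative\<close> picks some derivative; it is determined on \<^term>\<open>UNIV\<close> and
  on the regions \<open>K_slab a b\<close> with \<open>0 \<le> a < b\<close> below, because near each of their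
  points these contain a truncated open cone with that point as vertex.  On a bounding
  hyperboloid the \<open>t\<close>-derivative is therefore the one-sided one.
\<close>

definition dir_deriv :: "'a::euclidean_space set \<Rightarrow> 'a \<Rightarrow> ('a \<Rightarrow> real) \<Rightarrow> 'a \<Rightarrow> real" where
  "dir_deriv S v f p = frechet_derivative f (at p within S) v"

primrec C_diff_on :: "nat \<Rightarrow> 'a::euclidean_space set \<Rightarrow> ('a \<Rightarrow> real) \<Rightarrow> bool" where
  "C_diff_on 0 S f \<longleftrightarrow> continuous_on S f"
| "C_diff_on (Suc k) S f \<longleftrightarrow>
     f differentiable_on S \<and> (\<forall>v\<in>Basis. C_diff_on k S (dir_deriv S v f))"

definition e_t :: spacetime where
  "e_t = (1, 0)"

definition e_x :: "2 \<Rightarrow> spacetime" where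
  "e_x i = (0, axis i 1)"

definition box_op :: "spacetime set \<Rightarrow> (spacetime \<Rightarrow> real) \<Rightarrow> spacetime \<Rightarrow> real" where
  "box_op S u p =
     dir_deriv S e_t (dir_deriv S e_t u) p
       - (\<Sum>i\<in>UNIV. dir_deriv S (e_x i) (dir_deriv S (e_x i) u) p)"

definition K_cone :: "spacetime set" where
  "K_cone = {(t, x). t > norm x + 1}"

definition K_bdry :: "spacetime set" where
  "K_bdry = {(t, x). t = norm x + 1}"

definition hyperboloid :: "real \<Rightarrow> spacetime set" where
  "hyperboloid s = {(t, x). t = sqrt (s\<^sup>2 + (norm x)\<^sup>2)}"

definition K_slab :: "real \<Rightarrow> real \<Rightarrow> spacetime set" where
  "K_slab a b =
     {(t, x) \<in> K_cone. sqrt (a\<^sup>2 + (norm x)\<^sup>2) \<le> t \<and> t \<le> sqrt (b\<^sup>2 + (norm x)\<^sup>2)}"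

definition vanishes_near_bdry :: "spacetime set \<Rightarrow> (spacetime \<Rightarrow> real) \<Rightarrow> bool" where
  "vanishes_near_bdry S f \<longleftrightarrow>
     (\<exists>U. open U \<and> K_bdry \<subseteq> U \<and> (\<forall>p\<in>U \<inter> S. f p = 0))"

text \<open>
  A function on the hyperboloid \<open>hyperboloid s\<close> is a function on space-time of which only the values
  on the hyperboloid matter; its smoothness is smoothness in the global chart \<open>x\<close>.
\<close>

definition hyp_supp :: "real \<Rightarrow> (spacetime \<Rightarrow> real) \<Rightarrow> spacetime set" where
  "hyp_supp s f = closure {p \<in> hyperboloid s. f p \<noteq> 0}"

definition Cc_inf_hyp :: "real \<Rightarrow> (spacetime \<Rightarrow> real) \<Rightarrow> bool" where
  "Cc_inf_hyp s f \<longleftrightarrow>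
     (\<forall>k. C_diff_on k UNIV (\<lambda>x. f (sqrt (s\<^sup>2 + (norm x)\<^sup>2), x))) \<and>
     compact (hyp_supp s f)"

end

theory Submission
  imports Defs
begin

text \<open>
  The wave operator obeys a comparison principle on the region above the hyperboloid \<open>s = 2\<close>: a
  function with zero Cauchy data there and nonnegative d'Alembertian is nonnegative.  By descent from
  three space dimensions, the value of such a function \<open>w\<close> at \<open>X\<close> with \<open>s = S\<close> is an integral of
  \<open>\<box>w\<close> against a positive weight: in a Lorentz frame \<open>e0 = X / S\<close>, \<open>e1\<close>, \<open>e2\<close>, the points
  \<open>X - \<rho> (e0 - sin \<phi> (cos \<theta> e1 + sin \<theta> e2))\<close> are the projections of the backward light cone of
  \<open>X\<close> in \<open>\<real>\<^sup>1\<^sup>+\<^sup>3\<close>, and along this cone Kirchhoff's formula is an identity between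
  \<open>\<rho> sin \<phi> \<box>w\<close> and derivatives in \<open>\<rho>\<close>, \<open>\<phi>\<close> and \<open>\<theta>\<close>.

  Subtract from \<open>u\<close>, extended by zero beyond the cone, a compactly supported function with the same
  Cauchy data.  The difference is dominated by two explicit supersolutions with zero Cauchy data:
  \<open>(s - 2)\<^sup>2 / (s (s + t)) \<le> s / t\<close>, whose source is at least \<open>1 / (4 t\<^sup>2)\<close>, takes care of \<open>F\<close>,
  and a function bounded by \<open>1 / s\<close> with everywhere positive source absorbs the compactly
  supported source produced by the data.
\<close>

text \<open>The fundamental solution in two space dimensions is unbounded at the light cone. Lifting
  to three dimensions replaces it by the bounded weight \<open>\<rho> * sin \<phi>\<close>, so that
  the fundamental theorem of calculus and Fubini on compact sets suffice. The frame adapted to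
  \<open>X\<close> makes s^2 along the cone a function of \<open>\<rho>\<close> and
  \<open>\<phi>\<close> alone, hence the domain of integration is a product with a full circle in
  \<open>\<theta>\<close>. The backward cone of a point of \<open>K_cone\<close> may leave
  \<open>K_cone\<close> before it reaches s = 2; the extension of \<open>u\<close> by zero is what
  gives the comparison a domain closed under backward cones. One supersolution would not do: s / t
  does not decay along rays, while the contribution of the data must be O(1/s). All domains are
  closed and derivatives at their boundary are one-sided. Symmetry of second derivatives is
  therefore known only in the interior; it enters only the derivative in \<open>\<rho>\<close>,
  which is needed only there.\<close>

section \<open>Functions of class \<open>C\<^sup>2\<close> on a set\<close>

text \<open>Derivatives are carried as explicit functions, so that rules of calculus yield formulas
  for them. In \<open>f'' p a b\<close> the first differentiation is along \<open>a\<close>, the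
  second along \<open>b\<close>. Linearity in \<open>b\<close> comes with
  \<open>has_derivative\<close>, so only linearity in \<open>a\<close> is listed; symmetry is not
  built in.\<close>

definition C2_on ::
  "'a::euclidean_space set \<Rightarrow> ('a \<Rightarrow> real) \<Rightarrow> ('a \<Rightarrow> 'a \<Rightarrow> real) \<Rightarrow> ('a \<Rightarrow> 'a \<Rightarrow> 'a \<Rightarrow> real) \<Rightarrow> bool"
  where "C2_on S f f' f'' \<longleftrightarrow>
    (\<forall>p\<in>S. (f has_derivative f' p) (at p within S)) \<and>
    (\<forall>p\<in>S. \<forall>a. ((\<lambda>q. f' q a) has_derivative f'' p a) (at p within S)) \<and>
    (\<forall>p\<in>S. \<forall>b. linear (\<lambda>a. f'' p a b)) \<and>
    (\<forall>a b. continuous_on S (\<lambda>p. f'' p a b))"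

lemma C2_onD:
  assumes "C2_on S f f' f''"
  shows "p \<in> S \<Longrightarrow> (f has_derivative f' p) (at p within S)"
    and "p \<in> S \<Longrightarrow> ((\<lambda>q. f' q a) has_derivative f'' p a) (at p within S)"
    and "p \<in> S \<Longrightarrow> linear (\<lambda>a. f'' p a b)"
    and "continuous_on S (\<lambda>p. f'' p a b)"
    and "continuous_on S (\<lambda>p. f' p a)"
    and "continuous_on S f"
    and "p \<in> S \<Longrightarrow> linear (f' p)"
    and "p \<in> S \<Longrightarrow> bilinear (f'' p)"
proof -
  note * = assms[unfolded C2_on_def]
  show d: "p \<in> S \<Longrightarrow> (f has_derivative f' p) (at p within S)"
    and d2: "p \<in> S \<Longrightarrow> ((\<lambda>q. f' q a) has_derivative f'' p a) (at p within S)"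
    and l: "p \<in> S \<Longrightarrow> linear (\<lambda>a. f'' p a b)"
    and "continuous_on S (\<lambda>p. f'' p a b)" for p a b
    using * by blast+
  show "continuous_on S f"
    using d by (rule has_derivative_continuous_on)
  show "continuous_on S (\<lambda>p. f' p a)"
    by (rule has_derivative_continuous_on[where f'="\<lambda>p. f'' p a"]) (rule d2)
  show "p \<in> S \<Longrightarrow> linear (f' p)"
    using d has_derivative_linear by blast
  show "p \<in> S \<Longrightarrow> bilinear (f'' p)"
    using d2 l unfolding bilinear_def by (blast intro: has_derivative_linear)
qed

text \<open>The chain rule is relative to \<open>I\<close>, so that a curve may begin or end on the
  boundary of \<open>S\<close>, where only derivatives within \<open>S\<close> are given.\<close>

lemma C2_on_along:
  assumes "C2_on S f f' f''" "g ` I \<subseteq> S" "x \<in> I"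
    and g: "(g has_vector_derivative g') (at x within I)"
  shows "((\<lambda>x. f (g x)) has_real_derivative f' (g x) g') (at x within I)"
    and "((\<lambda>x. f' (g x) a) has_real_derivative f'' (g x) a g') (at x within I)"
proof -
  have gx: "g x \<in> S" using assms by auto
  have *: "((\<lambda>x. h (g x)) has_real_derivative h' (g x) g') (at x within I)"
    if "\<And>p. p \<in> S \<Longrightarrow> (h has_derivative h' p) (at p within S)" for h h'
  proof -
    have "((\<lambda>x. h (g x)) has_derivative (\<lambda>y. h' (g x) (y *\<^sub>R g'))) (at x within I)"
      using has_derivative_in_compose2[OF that assms(2,3) g[unfolded has_vector_derivative_def]] .
    moreover have "linear (h' (g x))"
      using that[OF gx] has_derivative_linear by blast
    ultimately show ?thesis
      by (simp add: has_field_derivative_def linear_scale mult.commute[of _ "h' (g x) g'"])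
  qed
  show "((\<lambda>x. f (g x)) has_real_derivative f' (g x) g') (at x within I)"
    by (rule *) (rule C2_onD(1)[OF assms(1)])
  show "((\<lambda>x. f' (g x) a) has_real_derivative f'' (g x) a g') (at x within I)"
    by (rule *[where h="\<lambda>q. f' q a" and h'="\<lambda>p. f'' p a"]) (rule C2_onD(2)[OF assms(1)])
qed

section \<open>Integration over compact sets, one variable at a time\<close>

lemma integral_compact_Fubini:
  fixes f :: "'a::euclidean_space \<times> 'b::euclidean_space \<Rightarrow> real"
  assumes "compact E" "continuous_on E f"
  shows "(LINT p:E|lborel. f p) = (LINT x|lborel. (LINT y:{y. (x, y) \<in> E}|lborel. f (x, y)))"
    and "(LINT p:E|lborel. f p) = (LINT y|lborel. (LINT x:{x. (x, y) \<in> E}|lborel. f (x, y)))"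
proof -
  have int: "integrable (lborel \<Otimes>\<^sub>M lborel) (\<lambda>p. indicator E p *\<^sub>R f p)"
    using borel_integrable_compact[OF assms] by (simp add: lborel_prod)
  show "(LINT p:E|lborel. f p) = (LINT x|lborel. (LINT y:{y. (x, y) \<in> E}|lborel. f (x, y)))"
    using lborel_pair.integral_fst'[OF int]
    by (simp add: set_lebesgue_integral_def lborel_prod indicator_def)
  show "(LINT p:E|lborel. f p) = (LINT y|lborel. (LINT x:{x. (x, y) \<in> E}|lborel. f (x, y)))"
    using lborel_pair.integral_snd[of "\<lambda>x y. indicator E (x, y) *\<^sub>R f (x, y)"] int
    by (simp add: set_lebesgue_integral_def lborel_prod indicator_def split_def)
qed

text \<open>Differentiability is asked only inside the interval: its endpoints will lie on
  hyperboloids, where second derivatives are not known to be symmetric.\<close>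

lemma LINT_Icc_FTC:
  fixes g :: "real \<Rightarrow> real"
  assumes "a \<le> b" "continuous_on {a..b} G" "continuous_on {a..b} g"
    and "\<And>x. x \<in> {a<..<b} \<Longrightarrow> (G has_real_derivative g x) (at x)"
  shows "(LINT x:{a..b}|lborel. g x) = G b - G a"
proof -
  have "(g has_integral G b - G a) {a..b}"
    using assms by (intro fundamental_theorem_of_calculus_interior)
      (auto simp: has_real_derivative_iff_has_vector_derivative)
  moreover have "set_integrable lborel {a..b} g"
    unfolding set_integrable_def using assms(3) by (intro borel_integrable_compact) auto
  ultimately show ?thesis
    using set_borel_integral_eq_integral(2) integral_unique by metis
qed

text \<open>For slices of the truncated cone, with s^2 as \<open>g\<close>. A slice is an interval
  that ends either at the limit of the variable or on the hyperboloid s^2 = \<open>c\<close>, where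
  boundary terms vanish.\<close>

lemma decreasing_superlevel_Icc:
  fixes g :: "real \<Rightarrow> real"
  assumes "a \<le> b" "continuous_on {a..b} g" "c \<le> g a"
    and mono: "\<And>x y. a \<le> x \<Longrightarrow> x < y \<Longrightarrow> y \<le> b \<Longrightarrow> g y < g x"
  obtains d where "a \<le> d" "d \<le> b" "{x. a \<le> x \<and> x \<le> b \<and> c \<le> g x} = {a..d}"
    "d = b \<or> g d = c" "\<And>x. a \<le> x \<Longrightarrow> x < d \<Longrightarrow> c < g x"
proof (cases "c \<le> g b")
  case True
  show ?thesis
  proof (rule that[of b])
    show "{x. a \<le> x \<and> x \<le> b \<and> c \<le> g x} = {a..b}"
    proof -
      have "c \<le> g x" if "a \<le> x" "x \<le> b" for x
        using True mono[of x b] that by (cases "x = b") auto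
      then show ?thesis by auto
    qed
    show "c < g x" if "a \<le> x" "x < b" for x
      using True mono[of x b] that by auto
  qed (use assms in auto)
next
  case False
  then obtain d where d: "a \<le> d" "d \<le> b" "g d = c"
    using IVT2'[of g b c a] assms by auto
  show ?thesis
  proof (rule that[of d])
    have "x \<le> d" if "x \<le> b" "c \<le> g x" for x
      using d mono[of d x] that by force
    moreover have "c \<le> g x" if "a \<le> x" "x \<le> d" for x
      using d mono[of x d] that by (cases "x = d") auto
    ultimately show "{x. a \<le> x \<and> x \<le> b \<and> c \<le> g x} = {a..d}"
      using d by auto
    show "c < g x" if "a \<le> x" "x < d" for x
      using d mono[of x d] that by auto
  qed (use d in auto)
qed

section \<open>Kirchhoff's formula along the backward cone\<close>

lemma set_integral_empty [simp]: "set_lebesgue_integral M {} f = 0"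
  by (simp add: set_lebesgue_integral_def)

text \<open>Kirchhoff's formula for a function independent of the third space variable, with polar
  angle \<open>\<phi>\<close> measured from that axis. Reflection in the equator makes the two
  hemispheres contribute equally; only \<open>\<phi> \<le> pi / 2\<close> is kept, which turns 4 pi
  into 2 pi.\<close>

lemma cone_integral_identity:
  fixes X e0 e1 e2 :: "'a::euclidean_space" and a S :: real
  defines "P \<equiv> \<lambda>\<rho> \<phi> \<theta>. X - \<rho> *\<^sub>R e0 + (\<rho> * sin \<phi>) *\<^sub>R (cos \<theta> *\<^sub>R e1 + sin \<theta> *\<^sub>R e2)"
    and "g \<equiv> \<lambda>\<rho> \<phi>. (S - \<rho>)\<^sup>2 - (\<rho> * sin \<phi>)\<^sup>2"
  defines "D \<equiv> {(\<rho>, \<phi>). 0 \<le> \<rho> \<and> \<rho> \<le> S \<and> 0 \<le> \<phi> \<and> \<phi> \<le> pi / 2 \<and> a\<^sup>2 \<le> g \<rho> \<phi>}"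
  assumes C2: "C2_on \<Sigma> w w' w''" and a: "0 < a" "a < S"
    and P_in: "\<And>\<rho> \<phi> \<theta>. 0 \<le> \<rho> \<Longrightarrow> \<rho> \<le> S \<Longrightarrow> a\<^sup>2 \<le> g \<rho> \<phi> \<Longrightarrow> P \<rho> \<phi> \<theta> \<in> \<Sigma>"
    and sym: "\<And>\<rho> \<phi> \<theta> u v. 0 < \<rho> \<Longrightarrow> \<rho> < S \<Longrightarrow> a\<^sup>2 < g \<rho> \<phi> \<Longrightarrow>
      w'' (P \<rho> \<phi> \<theta>) u v = w'' (P \<rho> \<phi> \<theta>) v u"
    and zero: "\<And>\<rho> \<phi> \<theta>. 0 \<le> \<rho> \<Longrightarrow> \<rho> \<le> S \<Longrightarrow> g \<rho> \<phi> = a\<^sup>2 \<Longrightarrow> w (P \<rho> \<phi> \<theta>) = 0"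
    and zero': "\<And>\<rho> \<phi> \<theta> v. 0 \<le> \<rho> \<Longrightarrow> \<rho> \<le> S \<Longrightarrow> g \<rho> \<phi> = a\<^sup>2 \<Longrightarrow> w' (P \<rho> \<phi> \<theta>) v = 0"
  shows "2 * pi * w X = (LINT x:D \<times> {0..2 * pi}|lborel.
    (case x of ((\<rho>, \<phi>), \<theta>) \<Rightarrow> \<rho> * sin \<phi> *
      (w'' (P \<rho> \<phi> \<theta>) e0 e0 - w'' (P \<rho> \<phi> \<theta>) e1 e1 - w'' (P \<rho> \<phi> \<theta>) e2 e2)))"
proof -
  \<comment> \<open>\<open>A\<close> is the weighted wave operator. \<open>B\<close> and
    \<open>C\<close> are the \<open>\<phi>\<close> and \<open>\<theta>\<close> parts of sin
    \<open>\<phi>\<close> / \<open>\<rho>\<close> times the Laplacian of the unit sphere applied to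
    \<open>w\<close> on the cone. The divisions by \<open>\<rho>\<close> and sin
    \<open>\<phi>\<close> are already carried out, so nothing is singular at the vertex or the pole.
    What remains, \<open>Z\<close>, is a \<open>\<rho>\<close>-derivative.\<close>
  define p1 where "p1 = (\<lambda>\<rho> \<phi> \<theta>. cos \<theta> * w' (P \<rho> \<phi> \<theta>) e1 + sin \<theta> * w' (P \<rho> \<phi> \<theta>) e2)"
  define A where "A = (\<lambda>\<rho> \<phi> \<theta>. \<rho> * sin \<phi> *
      (w'' (P \<rho> \<phi> \<theta>) e0 e0 - w'' (P \<rho> \<phi> \<theta>) e1 e1 - w'' (P \<rho> \<phi> \<theta>) e2 e2))"
  define B where "B = (\<lambda>\<rho> \<phi> \<theta>. ((cos \<phi>)\<^sup>2 - (sin \<phi>)\<^sup>2) * p1 \<rho> \<phi> \<theta> +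
      \<rho> * (cos \<phi>)\<^sup>2 * sin \<phi> * ((cos \<theta>)\<^sup>2 * w'' (P \<rho> \<phi> \<theta>) e1 e1
        + cos \<theta> * sin \<theta> * (w'' (P \<rho> \<phi> \<theta>) e1 e2 + w'' (P \<rho> \<phi> \<theta>) e2 e1)
        + (sin \<theta>)\<^sup>2 * w'' (P \<rho> \<phi> \<theta>) e2 e2))"
  define C where "C = (\<lambda>\<rho> \<phi> \<theta>. - p1 \<rho> \<phi> \<theta> +
      \<rho> * sin \<phi> * ((sin \<theta>)\<^sup>2 * w'' (P \<rho> \<phi> \<theta>) e1 e1
        - cos \<theta> * sin \<theta> * (w'' (P \<rho> \<phi> \<theta>) e1 e2 + w'' (P \<rho> \<phi> \<theta>) e2 e1)
        + (cos \<theta>)\<^sup>2 * w'' (P \<rho> \<phi> \<theta>) e2 e2))"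
  define Z where "Z = (\<lambda>\<rho> \<phi> \<theta>. - (A \<rho> \<phi> \<theta> + B \<rho> \<phi> \<theta> + C \<rho> \<phi> \<theta>))"
  define T where "T = {0..2 * pi}"

  have D_eq: "D = {0..S} \<times> {0..pi / 2} \<inter> {x. a\<^sup>2 \<le> g (fst x) (snd x)}"
    by (auto simp: D_def)
  have "closed {x. a\<^sup>2 \<le> g (fst x) (snd x)}"
    unfolding g_def by (intro closed_Collect_le continuous_intros)
  then have compD: "compact D"
    unfolding D_eq by (intro compact_Int_closed compact_Times compact_Icc)
  then have compE: "compact (D \<times> T)"
    unfolding T_def by (intro compact_Times compact_Icc)
  have PD: "P \<rho> \<phi> \<theta> \<in> \<Sigma>" if "(\<rho>, \<phi>) \<in> D" for \<rho> \<phi> \<theta>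
    using that P_in by (auto simp: D_def)

  have contP: "continuous_on M (\<lambda>x. P (r x) (f x) (t x))"
    if "continuous_on M r" "continuous_on M f" "continuous_on M t" for M :: "'c::t2_space set" and r f t
    unfolding P_def by (intro continuous_intros that)
  have cont: "continuous_on M (\<lambda>x. w (P (r x) (f x) (t x)))"
      "continuous_on M (\<lambda>x. w' (P (r x) (f x) (t x)) u)"
      "continuous_on M (\<lambda>x. w'' (P (r x) (f x) (t x)) u v)"
    if c: "continuous_on M r" "continuous_on M f" "continuous_on M t"
      and "\<And>x. x \<in> M \<Longrightarrow> (r x, f x) \<in> D" for M :: "'c::t2_space set" and r f t u v
    using PD that
    by (auto intro: continuous_on_compose2[OF C2_onD(6)[OF C2] contP[OF c]]
      continuous_on_compose2[OF C2_onD(5)[OF C2] contP[OF c]]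
      continuous_on_compose2[OF C2_onD(4)[OF C2] contP[OF c]])
  have contABC: "continuous_on M (\<lambda>x. A (r x) (f x) (t x))"
      "continuous_on M (\<lambda>x. B (r x) (f x) (t x))"
      "continuous_on M (\<lambda>x. C (r x) (f x) (t x))"
      "continuous_on M (\<lambda>x. Z (r x) (f x) (t x))"
    if c: "continuous_on M r" "continuous_on M f" "continuous_on M t"
      and d: "\<And>x. x \<in> M \<Longrightarrow> (r x, f x) \<in> D" for M :: "'c::t2_space set" and r f t
    unfolding A_def B_def C_def p1_def Z_def
    by (intro continuous_intros c cont[OF c d]; assumption)+

  have lin: "linear (w' (P \<rho> \<phi> \<theta>))" "linear (w'' (P \<rho> \<phi> \<theta>) u)"
    if "(\<rho>, \<phi>) \<in> D" for \<rho> \<phi> \<theta> u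
    using PD[OF that] C2_onD(7)[OF C2] C2_onD(2)[OF C2] has_derivative_linear by blast+
  note lins = linear_add[OF lin(1)] linear_diff[OF lin(1)] linear_scale[OF lin(1)] linear_neg[OF lin(1)]
    linear_add[OF lin(2)] linear_diff[OF lin(2)] linear_scale[OF lin(2)] linear_neg[OF lin(2)]

  have intC: "(LINT x:D \<times> T|lborel. (case x of ((\<rho>, \<phi>), \<theta>) \<Rightarrow> C \<rho> \<phi> \<theta>)) = 0"
  proof -
    have *: "(LINT \<theta>:T|lborel. C \<rho> \<phi> \<theta>) = 0" if "(\<rho>, \<phi>) \<in> D" for \<rho> \<phi>
    proof -
      \<comment> \<open>This is the \<open>\<theta>\<close>-derivative of \<open>w\<close> on the
        cone divided by \<open>\<rho>\<close> sin \<open>\<phi>\<close>; its periodicity in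
        \<open>\<theta>\<close> kills the integral.\<close>
      define G where "G = (\<lambda>\<theta>. - sin \<theta> * w' (P \<rho> \<phi> \<theta>) e1 + cos \<theta> * w' (P \<rho> \<phi> \<theta>) e2)"
      have G: "(G has_real_derivative C \<rho> \<phi> \<theta>) (at \<theta>)" for \<theta>
      proof -
        have dP: "(P \<rho> \<phi> has_vector_derivative
            (\<rho> * sin \<phi>) *\<^sub>R (- sin \<theta> *\<^sub>R e1 + cos \<theta> *\<^sub>R e2)) (at \<theta> within UNIV)"
          unfolding P_def by (auto intro!: derivative_eq_intros)
        have "P \<rho> \<phi> ` UNIV \<subseteq> \<Sigma>" using PD[OF that] by auto
        note along = C2_on_along(2)[OF C2 this _ dP]
        show ?thesis
          unfolding G_def C_def p1_def
          by (rule derivative_eq_intros along UNIV_I refl)+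
            (use that in \<open>simp add: lins algebra_simps power2_eq_square\<close>)
      qed
      have "(LINT \<theta>:T|lborel. C \<rho> \<phi> \<theta>) = G (2 * pi) - G 0"
        unfolding T_def
      proof (rule LINT_Icc_FTC)
        show "continuous_on {0..2 * pi} G"
          using G by (intro continuous_at_imp_continuous_on) (auto dest: DERIV_isCont)
        show "continuous_on {0..2 * pi} (C \<rho> \<phi>)"
          using that by (intro contABC continuous_intros)
      qed (use G in auto)
      also have "\<dots> = 0" by (simp add: G_def P_def)
      finally show ?thesis .
    qed
    have "(LINT x:D \<times> T|lborel. (case x of ((\<rho>, \<phi>), \<theta>) \<Rightarrow> C \<rho> \<phi> \<theta>)) =
        (LINT x|lborel. (LINT \<theta>:{\<theta>. (x, \<theta>) \<in> D \<times> T}|lborel. (case x of (\<rho>, \<phi>) \<Rightarrow> C \<rho> \<phi> \<theta>)))"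
      by (subst integral_compact_Fubini(1)[OF compE])
        (auto simp: split_def intro!: contABC continuous_intros)
    also have "(\<lambda>x. LINT \<theta>:{\<theta>. (x, \<theta>) \<in> D \<times> T}|lborel. (case x of (\<rho>, \<phi>) \<Rightarrow> C \<rho> \<phi> \<theta>)) = (\<lambda>x. 0)"
    proof
      fix x
      show "(LINT \<theta>:{\<theta>. (x, \<theta>) \<in> D \<times> T}|lborel. (case x of (\<rho>, \<phi>) \<Rightarrow> C \<rho> \<phi> \<theta>)) = 0"
        using *[of "fst x" "snd x"] by (cases "x \<in> D") (auto simp: split_def)
    qed
    finally show ?thesis by simp
  qed

  have intB: "(LINT x:D \<times> T|lborel. (case x of ((\<rho>, \<phi>), \<theta>) \<Rightarrow> B \<rho> \<phi> \<theta>)) = 0"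
  proof -
    have *: "(LINT \<phi>:{\<phi>. (\<rho>, \<phi>) \<in> D}|lborel. B \<rho> \<phi> \<theta>) = 0" for \<rho> \<theta>
    proof (cases "0 \<le> \<rho> \<and> \<rho> \<le> S \<and> a\<^sup>2 \<le> g \<rho> 0")
      case False
      have "g \<rho> \<phi> \<le> g \<rho> 0" for \<phi> by (simp add: g_def)
      then have "{\<phi>. (\<rho>, \<phi>) \<in> D} = {}" using False order_trans by (auto simp: D_def)
      then show ?thesis by simp
    next
      case True
      obtain d where d: "0 \<le> d" "d \<le> pi / 2" "{\<phi>. (\<rho>, \<phi>) \<in> D} = {0..d}"
        "d = pi / 2 \<or> g \<rho> d = a\<^sup>2"
      \<comment> \<open>At the vertex \<open>g\<close> is constant in \<open>\<phi>\<close>, so the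
        strict monotonicity used for the other slices fails.\<close>
      proof (cases "\<rho> = 0")
        case True
        have "{\<phi>. (\<rho>, \<phi>) \<in> D} = {0..pi / 2}"
          using True a by (auto simp: D_def g_def intro: power_mono)
        with that[of "pi / 2"] show ?thesis by simp
      next
        case False
        have "g \<rho> y < g \<rho> x" if "0 \<le> x" "x < y" "y \<le> pi / 2" for x y
        proof -
          have "0 \<le> sin x" "sin x < sin y"
            using that by (auto intro!: sin_ge_zero sin_monotone_2pi)
          then show ?thesis
            using False True unfolding g_def
            by (intro diff_strict_left_mono power_strict_mono mult_strict_left_mono) auto
        qed
        moreover have "continuous_on {0..pi / 2} (g \<rho>)"
          unfolding g_def by (intro continuous_intros)
        ultimately obtain d where "0 \<le> d" "d \<le> pi / 2"
          "{x. 0 \<le> x \<and> x \<le> pi / 2 \<and> a\<^sup>2 \<le> g \<rho> x} = {0..d}" "d = pi / 2 \<or> g \<rho> d = a\<^sup>2"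
          using True by (elim decreasing_superlevel_Icc[of 0 "pi / 2" "g \<rho>" "a\<^sup>2", rotated 3]) auto
        then show ?thesis
          using that[of d] True by (simp add: D_def)
      qed
      \<comment> \<open>The flux in \<open>\<phi>\<close>. It vanishes at the pole through sin, at
        the equator through cos, and at an earlier end of the slice because \<open>w'\<close> is
        zero on the initial hyperboloid.\<close>
      define G where
        "G = (\<lambda>\<phi>. cos \<phi> * sin \<phi> * (cos \<theta> * w' (P \<rho> \<phi> \<theta>) e1 + sin \<theta> * w' (P \<rho> \<phi> \<theta>) e2))"
      have G: "(G has_real_derivative B \<rho> \<phi> \<theta>) (at \<phi> within {0..d})" if "\<phi> \<in> {0..d}" for \<phi>
      proof -
        have D: "(\<rho>, \<phi>) \<in> D" using that d(3) by blast
        have dP: "((\<lambda>\<phi>. P \<rho> \<phi> \<theta>) has_vector_derivative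
            (\<rho> * cos \<phi>) *\<^sub>R (cos \<theta> *\<^sub>R e1 + sin \<theta> *\<^sub>R e2)) (at \<phi> within {0..d})"
          unfolding P_def by (auto intro!: derivative_eq_intros)
        have "(\<lambda>\<phi>. P \<rho> \<phi> \<theta>) ` {0..d} \<subseteq> \<Sigma>" using PD d(3) by blast
        note along = C2_on_along(2)[OF C2 this that dP]
        show ?thesis
          unfolding G_def B_def p1_def
          by (rule derivative_eq_intros along refl)+
            (use D in \<open>simp add: lins algebra_simps power2_eq_square\<close>)
      qed
      have "(LINT \<phi>:{0..d}|lborel. B \<rho> \<phi> \<theta>) = G d - G 0"
      proof (rule LINT_Icc_FTC)
        show "continuous_on {0..d} G"
          using G by (rule DERIV_continuous_on)
        show "continuous_on {0..d} (\<lambda>\<phi>. B \<rho> \<phi> \<theta>)"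
          using d(3) by (intro contABC continuous_intros) blast
        show "(G has_real_derivative B \<rho> x \<theta>) (at x)" if "x \<in> {0<..<d}" for x
          using G[of x] that by (simp add: at_within_Icc_at)
      qed (use d in auto)
      also have "\<dots> = 0"
      proof -
        have "cos d = 0 \<or> g \<rho> d = a\<^sup>2" using d(4) cos_pi_half by metis
        then show ?thesis using zero'[of \<rho> d \<theta>] True by (auto simp: G_def)
      qed
      finally show ?thesis using d by simp
    qed
    have **: "(LINT x:D|lborel. (case x of (\<rho>, \<phi>) \<Rightarrow> B \<rho> \<phi> \<theta>)) = 0" for \<theta>
    proof -
      have "(LINT x:D|lborel. (case x of (\<rho>, \<phi>) \<Rightarrow> B \<rho> \<phi> \<theta>)) =
          (LINT \<rho>|lborel. (LINT \<phi>:{\<phi>. (\<rho>, \<phi>) \<in> D}|lborel. B \<rho> \<phi> \<theta>))"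
        by (subst integral_compact_Fubini(1)[OF compD])
          (auto simp: split_def intro!: contABC continuous_intros)
      then show ?thesis by (simp add: *)
    qed
    have "(LINT x:D \<times> T|lborel. (case x of ((\<rho>, \<phi>), \<theta>) \<Rightarrow> B \<rho> \<phi> \<theta>)) =
        (LINT \<theta>|lborel. (LINT x:{x. (x, \<theta>) \<in> D \<times> T}|lborel. (case x of (\<rho>, \<phi>) \<Rightarrow> B \<rho> \<phi> \<theta>)))"
      by (subst integral_compact_Fubini(2)[OF compE])
        (auto simp: split_def intro!: contABC continuous_intros)
    also have "(\<lambda>\<theta>. LINT x:{x. (x, \<theta>) \<in> D \<times> T}|lborel. (case x of (\<rho>, \<phi>) \<Rightarrow> B \<rho> \<phi> \<theta>)) = (\<lambda>\<theta>. 0)"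
    proof
      fix \<theta>
      show "(LINT x:{x. (x, \<theta>) \<in> D \<times> T}|lborel. (case x of (\<rho>, \<phi>) \<Rightarrow> B \<rho> \<phi> \<theta>)) = 0"
        using ** by (cases "\<theta> \<in> T") auto
    qed
    finally show ?thesis by simp
  qed

  have intZ: "(LINT x:D \<times> T|lborel. (case x of ((\<rho>, \<phi>), \<theta>) \<Rightarrow> Z \<rho> \<phi> \<theta>)) = - 2 * pi * w X"
  proof -
    have *: "(LINT \<rho>:{\<rho>. (\<rho>, \<phi>) \<in> D}|lborel. Z \<rho> \<phi> \<theta>) = - sin \<phi> * w X"
      if \<phi>: "0 \<le> \<phi>" "\<phi> \<le> pi / 2" for \<phi> \<theta>
    proof -
      have "g y \<phi> < g x \<phi>" if "0 \<le> x" "x < y" "y \<le> S" for x y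
      proof -
        have "(cos \<phi>)\<^sup>2 * (x + y) \<le> x + y"
          using that by (intro mult_left_le_one_le) (auto simp: abs_square_le_1)
        then have "0 < (y - x) * (2 * S - (cos \<phi>)\<^sup>2 * (x + y))"
          using that by (intro mult_pos_pos; linarith)
        also have "\<dots> = g x \<phi> - g y \<phi>"
          unfolding g_def power_mult_distrib sin_squared_eq by (simp add: algebra_simps power2_eq_square)
        finally show ?thesis by simp
      qed
      moreover have "continuous_on {0..S} (\<lambda>\<rho>. g \<rho> \<phi>)"
        unfolding g_def by (intro continuous_intros)
      moreover have "a\<^sup>2 \<le> g 0 \<phi>" using a by (simp add: g_def power_mono)
      ultimately obtain d where d: "0 \<le> d" "d \<le> S"
        "{x. 0 \<le> x \<and> x \<le> S \<and> a\<^sup>2 \<le> g x \<phi>} = {0..d}" "d = S \<or> g d \<phi> = a\<^sup>2"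
        and d_less: "\<And>x. 0 \<le> x \<Longrightarrow> x < d \<Longrightarrow> a\<^sup>2 < g x \<phi>"
        using a by (elim decreasing_superlevel_Icc[of 0 S "\<lambda>\<rho>. g \<rho> \<phi>" "a\<^sup>2", rotated 3]) auto
      \<comment> \<open>Here \<open>g\<close> is minus a square, hence below
        \<open>a\<^sup>2\<close>: every ray leaves through the initial hyperboloid, and only the
        vertex contributes a boundary term in \<open>\<rho>\<close>.\<close>
      have "\<not> a\<^sup>2 \<le> g S \<phi>"
        using zero_le_power2[of "S * sin \<phi>"] zero_less_power[OF a(1), of 2]
        by (simp only: g_def diff_self zero_power2)
      then have gd: "g d \<phi> = a\<^sup>2"
        using d by (metis (mono_tags, lifting) atLeastAtMost_iff mem_Collect_eq order_refl)
      have slice: "{\<rho>. (\<rho>, \<phi>) \<in> D} = {0..d}"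
        using d(3) \<phi> by (simp add: D_def)
      \<comment> \<open>With w_0 the derivative along \<open>e0\<close> and w_r the outward radial
        one, this is sin \<open>\<phi>\<close> times w + \<open>\<rho>\<close> (w_0 + w_r). Along
        the ray d/d\<open>\<rho>\<close> acts as w_r - w_0, so the second derivatives left are w_rr
        - w_00. At the vertex the value is sin \<open>\<phi>\<close> times
        \<open>w X\<close>.\<close>
      define G where "G = (\<lambda>\<rho>. sin \<phi> * (w (P \<rho> \<phi> \<theta>) + \<rho> * (w' (P \<rho> \<phi> \<theta>) e0
          + sin \<phi> * (cos \<theta> * w' (P \<rho> \<phi> \<theta>) e1 + sin \<theta> * w' (P \<rho> \<phi> \<theta>) e2))))"
      have "(LINT \<rho>:{0..d}|lborel. Z \<rho> \<phi> \<theta>) = G d - G 0"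
      proof (rule LINT_Icc_FTC)
        show "continuous_on {0..d} (\<lambda>\<rho>. Z \<rho> \<phi> \<theta>)"
          using slice by (intro contABC continuous_intros) blast
        show "continuous_on {0..d} G"
          unfolding G_def using slice by (intro continuous_intros cont) blast+
        show "(G has_real_derivative Z \<rho> \<phi> \<theta>) (at \<rho>)" if "\<rho> \<in> {0<..<d}" for \<rho>
        proof -
          have D: "(\<rho>, \<phi>) \<in> D" using that slice by auto
          have dP: "((\<lambda>\<rho>. P \<rho> \<phi> \<theta>) has_vector_derivative
              (- e0 + sin \<phi> *\<^sub>R (cos \<theta> *\<^sub>R e1 + sin \<theta> *\<^sub>R e2))) (at \<rho> within {0..d})"
            unfolding P_def by (auto intro!: derivative_eq_intros simp: algebra_simps)
          have "(\<lambda>\<rho>. P \<rho> \<phi> \<theta>) ` {0..d} \<subseteq> \<Sigma>" using PD slice by blast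
          note along = C2_on_along[OF C2 this _ dP]
          have "\<rho> \<in> {0..d}" using that by simp
          note along = along[OF this]
          \<comment> \<open>The mixed derivatives of w_0 and w_r cancel only by symmetry;
            \<open>d_less\<close> puts the point strictly above the initial hyperboloid.\<close>
          have s: "w'' (P \<rho> \<phi> \<theta>) e0 e1 = w'' (P \<rho> \<phi> \<theta>) e1 e0"
              "w'' (P \<rho> \<phi> \<theta>) e0 e2 = w'' (P \<rho> \<phi> \<theta>) e2 e0"
            using sym[of \<rho> \<phi> \<theta>] that d d_less[of \<rho>] by auto
          have c: "cos t * cos t = 1 - sin t * sin t" for t :: real
            using sin_cos_squared_add3[of t] by linarith
          have c': "cos t * (cos t * y) = y - sin t * (sin t * y)" for t y :: real
            unfolding mult.assoc[symmetric] c by (simp add: algebra_simps)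
          have "(G has_real_derivative Z \<rho> \<phi> \<theta>) (at \<rho> within {0..d})"
            unfolding G_def
            by (rule derivative_eq_intros along refl)+
              (use D in \<open>simp add: Z_def A_def B_def C_def p1_def lins s c c' algebra_simps power2_eq_square\<close>)
          then show ?thesis using that by (simp add: at_within_Icc_at)
        qed
      qed (use d in auto)
      also have "\<dots> = - sin \<phi> * w X"
        using d gd zero[of d \<phi> \<theta>] zero'[of d \<phi> \<theta>] by (simp add: G_def P_def)
      finally show ?thesis using slice by simp
    qed
    have **: "(LINT x:D|lborel. (case x of (\<rho>, \<phi>) \<Rightarrow> Z \<rho> \<phi> \<theta>)) = - w X" for \<theta>
    proof -
      have "(LINT x:D|lborel. (case x of (\<rho>, \<phi>) \<Rightarrow> Z \<rho> \<phi> \<theta>)) =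
          (LINT \<phi>|lborel. (LINT \<rho>:{\<rho>. (\<rho>, \<phi>) \<in> D}|lborel. Z \<rho> \<phi> \<theta>))"
        by (subst integral_compact_Fubini(2)[OF compD])
          (auto simp: split_def intro!: contABC continuous_intros)
      also have "\<dots> = (LINT \<phi>:{0..pi / 2}|lborel. - sin \<phi> * w X)"
        unfolding set_lebesgue_integral_def[where A="{0..pi / 2}"]
      proof (rule Bochner_Integration.integral_cong[OF refl])
        fix \<phi>
        show "(LINT \<rho>:{\<rho>. (\<rho>, \<phi>) \<in> D}|lborel. Z \<rho> \<phi> \<theta>) =
            indicat_real {0..pi / 2} \<phi> *\<^sub>R (- sin \<phi> * w X)"
        proof (cases "\<phi> \<in> {0..pi / 2}")
          case False
          then have "{\<rho>. (\<rho>, \<phi>) \<in> D} = {}" by (auto simp: D_def)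
          then show ?thesis using False by simp
        qed (use * in auto)
      qed
      also have "\<dots> = cos (pi / 2) * w X - cos 0 * w X"
        by (rule LINT_Icc_FTC) (auto intro!: derivative_eq_intros continuous_intros)
      finally show ?thesis by simp
    qed
    have "(LINT x:D \<times> T|lborel. (case x of ((\<rho>, \<phi>), \<theta>) \<Rightarrow> Z \<rho> \<phi> \<theta>)) =
        (LINT \<theta>|lborel. (LINT x:{x. (x, \<theta>) \<in> D \<times> T}|lborel. (case x of (\<rho>, \<phi>) \<Rightarrow> Z \<rho> \<phi> \<theta>)))"
      by (subst integral_compact_Fubini(2)[OF compE])
        (auto simp: split_def intro!: contABC continuous_intros)
    also have "\<dots> = (LINT \<theta>:T|lborel. - w X)"
      unfolding set_lebesgue_integral_def[where A=T]
    proof (rule Bochner_Integration.integral_cong[OF refl])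
      fix \<theta>
      show "(LINT x:{x. (x, \<theta>) \<in> D \<times> T}|lborel. (case x of (\<rho>, \<phi>) \<Rightarrow> Z \<rho> \<phi> \<theta>)) =
          indicat_real T \<theta> *\<^sub>R (- w X)"
        using ** by (cases "\<theta> \<in> T") auto
    qed
    also have "\<dots> = - (2 * pi) * w X - (- 0 * w X)"
      unfolding T_def by (rule LINT_Icc_FTC) (auto intro!: derivative_eq_intros continuous_intros)
    finally show ?thesis by simp
  qed

  have int: "set_integrable lborel (D \<times> T) (\<lambda>x. case x of ((\<rho>, \<phi>), \<theta>) \<Rightarrow> f \<rho> \<phi> \<theta>)"
    if "f = A \<or> f = B \<or> f = C" for f
    unfolding set_integrable_def split_def using that
    by (intro borel_integrable_compact compE) (auto intro!: contABC continuous_intros)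
  have "(LINT x:D \<times> T|lborel. (case x of ((\<rho>, \<phi>), \<theta>) \<Rightarrow> Z \<rho> \<phi> \<theta>)) =
      - ((LINT x:D \<times> T|lborel. (case x of ((\<rho>, \<phi>), \<theta>) \<Rightarrow> A \<rho> \<phi> \<theta>))
      + (LINT x:D \<times> T|lborel. (case x of ((\<rho>, \<phi>), \<theta>) \<Rightarrow> B \<rho> \<phi> \<theta>))
      + (LINT x:D \<times> T|lborel. (case x of ((\<rho>, \<phi>), \<theta>) \<Rightarrow> C \<rho> \<phi> \<theta>)))"
    using int[of A] int[of B] int[of C]
    by (simp add: Z_def split_def flip: set_integral_add(2) set_integral_uminus)
  then show ?thesis
    using intB intC intZ by (simp add: A_def T_def)
qed

section \<open>The comparison principle\<close>

text \<open>The mean value theorem is applied twice: along \<open>a\<close> to the difference of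
  \<open>f\<close> across the side \<open>b\<close>, then along \<open>b\<close> to
  \<open>f'\<close>.\<close>

lemma C2_on_second_difference:
  assumes C2: "C2_on S f f' f''" and h: "0 < h"
    and sq: "\<And>s t. 0 \<le> s \<Longrightarrow> s \<le> h \<Longrightarrow> 0 \<le> t \<Longrightarrow> t \<le> h \<Longrightarrow> p + s *\<^sub>R a + t *\<^sub>R b \<in> S"
  obtains s t where "0 \<le> s" "s \<le> h" "0 \<le> t" "t \<le> h"
    "f (p + h *\<^sub>R a + h *\<^sub>R b) - f (p + h *\<^sub>R a) - f (p + h *\<^sub>R b) + f p
      = h\<^sup>2 * f'' (p + s *\<^sub>R a + t *\<^sub>R b) a b"
proof -
  have d1: "((\<lambda>s. f (p + s *\<^sub>R a + t *\<^sub>R b)) has_real_derivative f' (p + s *\<^sub>R a + t *\<^sub>R b) a)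
      (at s within {0..h})" if "s \<in> {0..h}" "t \<in> {0..h}" for s t
  proof -
    have "((\<lambda>s. p + s *\<^sub>R a + t *\<^sub>R b) has_vector_derivative a) (at s within {0..h})"
      by (auto intro!: derivative_eq_intros)
    moreover have "(\<lambda>s. p + s *\<^sub>R a + t *\<^sub>R b) ` {0..h} \<subseteq> S" using sq that by auto
    ultimately show ?thesis using C2_on_along(1)[OF C2] that by blast
  qed
  have d2: "((\<lambda>t. f' (p + s *\<^sub>R a + t *\<^sub>R b) a) has_real_derivative f'' (p + s *\<^sub>R a + t *\<^sub>R b) a b)
      (at t within {0..h})" if "s \<in> {0..h}" "t \<in> {0..h}" for s t
  proof -
    have "((\<lambda>t. p + s *\<^sub>R a + t *\<^sub>R b) has_vector_derivative b) (at t within {0..h})"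
      by (auto intro!: derivative_eq_intros)
    moreover have "(\<lambda>t. p + s *\<^sub>R a + t *\<^sub>R b) ` {0..h} \<subseteq> S" using sq that by auto
    ultimately show ?thesis using C2_on_along(2)[OF C2] that by blast
  qed
  define G where "G = (\<lambda>s. f (p + s *\<^sub>R a + h *\<^sub>R b) - f (p + s *\<^sub>R a + 0 *\<^sub>R b))"
  have G: "(G has_real_derivative f' (p + s *\<^sub>R a + h *\<^sub>R b) a - f' (p + s *\<^sub>R a + 0 *\<^sub>R b) a)
      (at s within {0..h})" if "s \<in> {0..h}" for s
    unfolding G_def using h that by (intro derivative_intros d1) auto
  obtain s where s: "0 < s" "s < h"
    "G h - G 0 = h * (f' (p + s *\<^sub>R a + h *\<^sub>R b) a - f' (p + s *\<^sub>R a + 0 *\<^sub>R b) a)"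
    using mvt_simple[OF h G[unfolded has_field_derivative_def]] by (auto simp: mult.commute)
  then have "s \<in> {0..h}" by simp
  then obtain t where t: "0 < t" "t < h"
    "f' (p + s *\<^sub>R a + h *\<^sub>R b) a - f' (p + s *\<^sub>R a + 0 *\<^sub>R b) a = h * f'' (p + s *\<^sub>R a + t *\<^sub>R b) a b"
    using mvt_simple[OF h d2[OF \<open>s \<in> {0..h}\<close>, unfolded has_field_derivative_def]] by (auto simp: mult.commute)
  show ?thesis
    using that[of s t] s t by (simp add: G_def power2_eq_square)
qed

text \<open>Schwarz's theorem: the second difference over a small parallelogram does not depend on
  the order of its sides, so the two mixed derivatives agree at two nearby points, and continuity
  brings both points to \<open>p\<close>.\<close>

lemma C2_on_symmetric:
  assumes C2: "C2_on S f f' f''" and p: "p \<in> interior S"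
  shows "f'' p a b = f'' p b a"
proof (rule ccontr)
  assume ne: "f'' p a b \<noteq> f'' p b a"
  define e where "e = \<bar>f'' p a b - f'' p b a\<bar> / 2"
  have "e > 0" using ne by (simp add: e_def)
  have cont: "isCont (\<lambda>q. f'' q u v) p" for u v
    using C2_onD(4)[OF C2] p by (rule continuous_on_interior)
  have ev: "eventually (\<lambda>q. dist (f'' q u v) (f'' p u v) < e) (nhds p)" for u v
    using cont[of u v] \<open>e > 0\<close> tendsto_at_iff_tendsto_nhds[of "\<lambda>q. f'' q u v" p]
    by (intro tendstoD) (simp_all add: isCont_def)
  have "eventually (\<lambda>q. q \<in> interior S) (nhds p)"
    using p by (auto intro: eventually_nhds_in_open)
  from this ev[of a b] ev[of b a]
  have "eventually (\<lambda>q. q \<in> S \<and> dist (f'' q a b) (f'' p a b) < e \<and> dist (f'' q b a) (f'' p b a) < e) (nhds p)"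
    by eventually_elim (use interior_subset in auto)
  then obtain d where "d > 0"
    and d: "\<And>q. dist q p < d \<Longrightarrow>
      q \<in> S \<and> dist (f'' q a b) (f'' p a b) < e \<and> dist (f'' q b a) (f'' p b a) < e"
    unfolding eventually_nhds_metric by blast
  \<comment> \<open>This keeps the parallelogram with sides \<open>h *\<^sub>R a\<close> and
    \<open>h *\<^sub>R b\<close> inside the ball of radius \<open>d\<close>; the summand 1 keeps the
    denominator positive when \<open>a\<close> and \<open>b\<close> vanish.\<close>
  define h where "h = d / (norm a + norm b + 1)"
  have h: "h > 0" using \<open>d > 0\<close> by (auto simp: h_def intro!: divide_pos_pos add_nonneg_pos)
  have near: "dist (p + s *\<^sub>R u + t *\<^sub>R v) p < d"
    if "0 \<le> s" "s \<le> h" "0 \<le> t" "t \<le> h" "u = a \<and> v = b \<or> u = b \<and> v = a" for s t u v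
  proof -
    have "dist (p + s *\<^sub>R u + t *\<^sub>R v) p \<le> s * norm u + t * norm v"
      using that norm_triangle_ineq[of "s *\<^sub>R u" "t *\<^sub>R v"] by (simp add: dist_norm add.assoc)
    also have "\<dots> \<le> h * norm u + h * norm v"
      using that by (intro add_mono mult_right_mono) auto
    also have "\<dots> < h * (norm a + norm b + 1)"
      using that h by (auto simp: algebra_simps)
    also have "\<dots> = d"
    proof -
      have "norm a + norm b + 1 \<noteq> 0" using norm_ge_zero[of a] norm_ge_zero[of b] by linarith
      then show ?thesis by (simp add: h_def)
    qed
    finally show ?thesis .
  qed
  obtain s t where st: "0 \<le> s" "s \<le> h" "0 \<le> t" "t \<le> h"
    "f (p + h *\<^sub>R a + h *\<^sub>R b) - f (p + h *\<^sub>R a) - f (p + h *\<^sub>R b) + f p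
      = h\<^sup>2 * f'' (p + s *\<^sub>R a + t *\<^sub>R b) a b"
    by (rule C2_on_second_difference[OF C2 h, of p a b]) (use near d in auto)
  obtain s' t' where st': "0 \<le> s'" "s' \<le> h" "0 \<le> t'" "t' \<le> h"
    "f (p + h *\<^sub>R b + h *\<^sub>R a) - f (p + h *\<^sub>R b) - f (p + h *\<^sub>R a) + f p
      = h\<^sup>2 * f'' (p + s' *\<^sub>R b + t' *\<^sub>R a) b a"
    by (rule C2_on_second_difference[OF C2 h, of p b a]) (use near d in auto)
  have swap: "p + h *\<^sub>R b + h *\<^sub>R a = p + h *\<^sub>R a + h *\<^sub>R b" by simp
  have "h\<^sup>2 * f'' (p + s *\<^sub>R a + t *\<^sub>R b) a b = h\<^sup>2 * f'' (p + s' *\<^sub>R b + t' *\<^sub>R a) b a"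
    using st(5) st'(5) unfolding swap by linarith
  then have "f'' (p + s *\<^sub>R a + t *\<^sub>R b) a b = f'' (p + s' *\<^sub>R b + t' *\<^sub>R a) b a"
    using h by simp
  moreover have "dist (f'' (p + s *\<^sub>R a + t *\<^sub>R b) a b) (f'' p a b) < e"
    using d near[of s t a b] st by blast
  moreover have "dist (f'' (p + s' *\<^sub>R b + t' *\<^sub>R a) b a) (f'' p b a) < e"
    using d near[of s' t' b a] st' by blast
  ultimately show False
    unfolding e_def dist_real_def by (auto simp: abs_if split: if_splits)
qed

section \<open>Minkowski geometry and positivity\<close>

definition lorentz_sq :: "spacetime \<Rightarrow> real" where
  "lorentz_sq p = (fst p)\<^sup>2 - (norm (snd p))\<^sup>2"

text \<open>There is no condition on the solid cone: the backward cone of a point stays in this set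
  until it meets s = \<open>a\<close>. The sign of \<open>fst p\<close> selects the future
  sheet.\<close>

definition hyp_shell :: "real \<Rightarrow> real \<Rightarrow> spacetime set" where
  "hyp_shell a b = {p. 0 < fst p \<and> a\<^sup>2 \<le> lorentz_sq p \<and> lorentz_sq p \<le> b\<^sup>2}"

text \<open>Contraction with the Minkowski metric: it gives the d'Alembertian when applied to a
  Hessian, and the inner product of gradients when applied to a product of two
  differentials.\<close>

definition lorentz_trace :: "(spacetime \<Rightarrow> spacetime \<Rightarrow> real) \<Rightarrow> real" where
  "lorentz_trace B = B e_t e_t - (\<Sum>i\<in>UNIV. B (e_x i) (e_x i))"

text \<open>Lorentz invariance of the trace, for the frame obtained by a boost along
  \<open>k\<close> with \<open>\<gamma>\<close> and \<open>\<beta>\<close> as hyperbolic cosine and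
  sine, completed by \<open>k\<close> turned through a right angle.\<close>

lemma lorentz_trace_frame:
  fixes k :: "real ^ 2"
  assumes B: "bilinear B" and k: "norm k = 1" and \<gamma>: "\<gamma>\<^sup>2 = 1 + \<beta>\<^sup>2"
  shows "lorentz_trace B = B (\<gamma>, \<beta> *\<^sub>R k) (\<gamma>, \<beta> *\<^sub>R k) - B (\<beta>, \<gamma> *\<^sub>R k) (\<beta>, \<gamma> *\<^sub>R k)
      - B (0, vector [- k $ 2, k $ 1]) (0, vector [- k $ 2, k $ 1])"
proof -
  have decomp: "(t, x) = t *\<^sub>R e_t + (x $ 1) *\<^sub>R e_x 1 + (x $ 2) *\<^sub>R e_x 2" for t and x :: "real ^ 2"
    by (auto simp: e_t_def e_x_def vec_eq_iff axis_def forall_2)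
  have k1: "(k $ 2)\<^sup>2 = 1 - (k $ 1)\<^sup>2"
    using k by (simp add: norm_eq_1 inner_vec_def sum_2 power2_eq_square)
  have c: "\<gamma> * \<gamma> = 1 + \<beta> * \<beta>" "k $ 2 * k $ 2 = 1 - k $ 1 * k $ 1"
    using \<gamma> k1 by (simp_all add: power2_eq_square)
  have c': "\<gamma> * (\<gamma> * y) = y + \<beta> * (\<beta> * y)" "k $ 2 * (k $ 2 * y) = y - k $ 1 * (k $ 1 * y)" for y
    unfolding mult.assoc[symmetric] c by (simp_all add: algebra_simps)
  show ?thesis
    unfolding decomp[of \<gamma>] decomp[of \<beta>] decomp[of 0] lorentz_trace_def sum_2
    by (simp add: bilinear_ladd[OF B] bilinear_radd[OF B] bilinear_lmul[OF B] bilinear_rmul[OF B]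
        bilinear_lsub[OF B] bilinear_rsub[OF B]
        c c' algebra_simps)
qed

lemma wave_positivity:
  assumes a: "0 < a"
    and C2: "C2_on (hyp_shell a b) h h' h''"
    and zero: "\<And>p. p \<in> hyp_shell a b \<Longrightarrow> lorentz_sq p = a\<^sup>2 \<Longrightarrow> h p = 0"
    and zero': "\<And>p v. p \<in> hyp_shell a b \<Longrightarrow> lorentz_sq p = a\<^sup>2 \<Longrightarrow> h' p v = 0"
    and pos: "\<And>p. p \<in> hyp_shell a b \<Longrightarrow> 0 \<le> lorentz_trace (h'' p)"
    and X: "X \<in> hyp_shell a b"
  shows "0 \<le> h X"
proof (cases "lorentz_sq X = a\<^sup>2")
  case True
  then show ?thesis using zero[OF X] by simp
next
  case False
  define S where "S = sqrt (lorentz_sq X)"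
  have X': "0 < fst X" "a\<^sup>2 < lorentz_sq X" "lorentz_sq X \<le> b\<^sup>2"
    using X False by (auto simp: hyp_shell_def)
  have "0 < a\<^sup>2" using a by simp
  then have S2: "S\<^sup>2 = lorentz_sq X" unfolding S_def using X' by (intro real_sqrt_pow2) linarith
  have "a < S" unfolding S_def using X' a by (intro real_less_rsqrt) auto
  then have "0 < S" using a by simp
  define \<beta> where "\<beta> = norm (snd X) / S"
  define \<gamma> where "\<gamma> = fst X / S"
  obtain k :: "real ^ 2" where k: "norm k = 1" "snd X = norm (snd X) *\<^sub>R k"
  proof (cases "snd X = 0")
    case True
    then show ?thesis using that[of "axis 1 1"] by simp
  next
    case False
    then show ?thesis using that[of "snd X /\<^sub>R norm (snd X)"] by simp
  qed
  have \<beta>\<gamma>: "0 \<le> \<beta>" "0 < \<gamma>" "\<gamma>\<^sup>2 = 1 + \<beta>\<^sup>2"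
    using \<open>0 < S\<close> X' S2 by (auto simp: \<beta>_def \<gamma>_def power_divide field_simps lorentz_sq_def)
  then have "\<beta> < \<gamma>" by (intro power2_less_imp_less[of \<beta> \<gamma>]) auto
  define e0 :: spacetime where "e0 = (\<gamma>, \<beta> *\<^sub>R k)"
  define e1 :: spacetime where "e1 = (\<beta>, \<gamma> *\<^sub>R k)"
  define m :: "real ^ 2" where "m = vector [- k $ 2, k $ 1]"
  define e2 :: spacetime where "e2 = (0, m)"
  have Xe0: "X = S *\<^sub>R e0"
    using \<open>0 < S\<close> k by (simp add: e0_def \<gamma>_def \<beta>_def prod_eq_iff)
  define P where
    "P = (\<lambda>\<rho> \<phi> \<theta>. X - \<rho> *\<^sub>R e0 + (\<rho> * sin \<phi>) *\<^sub>R (cos \<theta> *\<^sub>R e1 + sin \<theta> *\<^sub>R e2))"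
  define g where "g = (\<lambda>\<rho> \<phi>. (S - \<rho>)\<^sup>2 - (\<rho> * sin \<phi>)\<^sup>2)"
  have km: "k \<bullet> k = 1" "m \<bullet> m = 1" "k \<bullet> m = 0" "m \<bullet> k = 0"
    using k by (auto simp: m_def norm_eq_1 inner_vec_def sum_2)
  have PQ: "lorentz_sq (P \<rho> \<phi> \<theta>) = g \<rho> \<phi>" for \<rho> \<phi> \<theta>
  proof -
    define u v w where "u = S - \<rho>" and "v = \<rho> * sin \<phi> * cos \<theta>" and "w = \<rho> * sin \<phi> * sin \<theta>"
    have "P \<rho> \<phi> \<theta> = (u * \<gamma> + v * \<beta>, (u * \<beta> + v * \<gamma>) *\<^sub>R k + w *\<^sub>R m)"
      by (simp add: P_def Xe0 e0_def e1_def e2_def u_def v_def w_def algebra_simps)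
    then have "lorentz_sq (P \<rho> \<phi> \<theta>) = (u * \<gamma> + v * \<beta>)\<^sup>2 - ((u * \<beta> + v * \<gamma>)\<^sup>2 + w\<^sup>2)"
      unfolding lorentz_sq_def power2_norm_eq_inner
      by (simp add: inner_add_left inner_add_right km power2_eq_square)
    also have "\<dots> = (\<gamma>\<^sup>2 - \<beta>\<^sup>2) * (u\<^sup>2 - v\<^sup>2) - w\<^sup>2" by (simp add: power2_eq_square algebra_simps)
    also have "\<dots> = u\<^sup>2 - (v\<^sup>2 + w\<^sup>2)" using \<beta>\<gamma> by simp
    also have "v\<^sup>2 + w\<^sup>2 = (\<rho> * sin \<phi>)\<^sup>2 * ((cos \<theta>)\<^sup>2 + (sin \<theta>)\<^sup>2)"
      unfolding v_def w_def by (simp add: power_mult_distrib algebra_simps del: sin_cos_squared_add2)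
    finally show ?thesis unfolding sin_cos_squared_add2 by (simp add: g_def u_def)
  qed
  \<comment> \<open>The condition on \<open>g\<close> gives |\<open>\<rho>\<close> sin
    \<open>\<phi>\<close>| < S - \<open>\<rho>\<close>. As \<open>\<beta>\<close> <
    \<open>\<gamma>\<close>, the spatial displacement cannot outweigh the remaining proper time, so
    the point stays on the future sheet.\<close>
  have P_pos: "0 < fst (P \<rho> \<phi> \<theta>)" if "0 \<le> \<rho>" "\<rho> \<le> S" "a\<^sup>2 \<le> g \<rho> \<phi>" for \<rho> \<phi> \<theta>
  proof -
    have "(\<rho> * sin \<phi>)\<^sup>2 < (S - \<rho>)\<^sup>2" using that(3) \<open>0 < a\<^sup>2\<close> unfolding g_def by linarith
    then have *: "\<bar>\<rho> * sin \<phi>\<bar> < S - \<rho>"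
      using that by (metis abs_le_square_iff abs_of_nonneg diff_ge_0_iff_ge not_le)
    have "- (\<rho> * sin \<phi> * cos \<theta> * \<beta>) \<le> \<bar>\<rho> * sin \<phi>\<bar> * \<bar>cos \<theta>\<bar> * \<beta>"
      using \<beta>\<gamma> by (metis abs_ge_minus_self abs_mult abs_of_nonneg)
    also have "\<dots> \<le> \<bar>\<rho> * sin \<phi>\<bar> * 1 * \<beta>"
      using \<beta>\<gamma> by (intro mult_right_mono mult_left_mono) auto
    also have "\<dots> \<le> (S - \<rho>) * \<beta>" using * \<beta>\<gamma> by (auto intro: mult_right_mono)
    also have "\<dots> < (S - \<rho>) * \<gamma>" using * \<open>\<beta> < \<gamma>\<close> by (intro mult_strict_left_mono) auto
    finally show ?thesis
      by (simp add: P_def Xe0 e0_def e1_def e2_def algebra_simps)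
  qed
  have g_le: "g \<rho> \<phi> \<le> lorentz_sq X" if "0 \<le> \<rho>" "\<rho> \<le> S" for \<rho> \<phi>
  proof -
    have "g \<rho> \<phi> \<le> (S - \<rho>)\<^sup>2" by (simp add: g_def)
    also have "\<dots> \<le> S\<^sup>2" using that by (intro power_mono) auto
    finally show ?thesis using S2 by simp
  qed
  have P_in: "P \<rho> \<phi> \<theta> \<in> hyp_shell a b" if "0 \<le> \<rho>" "\<rho> \<le> S" "a\<^sup>2 \<le> g \<rho> \<phi>" for \<rho> \<phi> \<theta>
    using that P_pos[OF that] g_le[OF that(1,2)] X' by (auto simp: hyp_shell_def PQ intro: order_trans)
  \<comment> \<open>For \<open>\<rho> > 0\<close> the value of s^2 falls strictly below that at
    \<open>X\<close>, so the point is interior even when \<open>X\<close> itself lies on the upper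
    hyperboloid.\<close>
  have sym: "h'' (P \<rho> \<phi> \<theta>) u v = h'' (P \<rho> \<phi> \<theta>) v u"
    if "0 < \<rho>" "\<rho> < S" "a\<^sup>2 < g \<rho> \<phi>" for \<rho> \<phi> \<theta> u v
  proof (rule C2_on_symmetric[OF C2])
    define U :: "spacetime set" where "U = {p. 0 < fst p} \<inter> {p. a\<^sup>2 < lorentz_sq p} \<inter> {p. lorentz_sq p < b\<^sup>2}"
    have "g \<rho> \<phi> \<le> (S - \<rho>)\<^sup>2" by (simp add: g_def)
    also have "\<dots> < S\<^sup>2" using that by (intro power_strict_mono) auto
    finally have "g \<rho> \<phi> < b\<^sup>2" using S2 X' by simp
    then have "P \<rho> \<phi> \<theta> \<in> U" using that P_pos[of \<rho> \<phi> \<theta>] by (simp add: U_def PQ)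
    moreover have "open U"
      unfolding U_def lorentz_sq_def by (intro open_Int open_Collect_less continuous_intros)
    moreover have "U \<subseteq> hyp_shell a b" by (auto simp: U_def hyp_shell_def)
    ultimately show "P \<rho> \<phi> \<theta> \<in> interior (hyp_shell a b)" by (auto intro: interiorI)
  qed
  have Pg: "P \<rho> \<phi> \<theta> = X - \<rho> *\<^sub>R e0 + (\<rho> * sin \<phi>) *\<^sub>R (cos \<theta> *\<^sub>R e1 + sin \<theta> *\<^sub>R e2)"
    "g \<rho> \<phi> = (S - \<rho>)\<^sup>2 - (\<rho> * sin \<phi>)\<^sup>2" for \<rho> \<phi> \<theta>
    by (simp_all add: P_def g_def)
  have "2 * pi * h X = (LINT x:{(\<rho>, \<phi>). 0 \<le> \<rho> \<and> \<rho> \<le> S \<and> 0 \<le> \<phi> \<and> \<phi> \<le> pi / 2 \<and> a\<^sup>2 \<le> g \<rho> \<phi>} \<times> {0..2 * pi}|lborel.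
    (case x of ((\<rho>, \<phi>), \<theta>) \<Rightarrow> \<rho> * sin \<phi> *
      (h'' (P \<rho> \<phi> \<theta>) e0 e0 - h'' (P \<rho> \<phi> \<theta>) e1 e1 - h'' (P \<rho> \<phi> \<theta>) e2 e2)))"
    unfolding P_def g_def
  proof (rule cone_integral_identity[where X=X and ?e0.0=e0 and ?e1.0=e1 and ?e2.0=e2 and S=S and a=a,
        OF C2 \<open>0 < a\<close> \<open>a < S\<close>], fold Pg)
  qed (use P_in sym PQ in \<open>auto intro!: zero zero'\<close>)
  also have "0 \<le> \<dots>"
    unfolding set_lebesgue_integral_def
  proof (intro Bochner_Integration.integral_nonneg)
    fix x :: "(real \<times> real) \<times> real"
    obtain \<rho> \<phi> \<theta> where x: "x = ((\<rho>, \<phi>), \<theta>)" by (metis surj_pair)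
    have "0 \<le> \<rho> * sin \<phi> * (h'' (P \<rho> \<phi> \<theta>) e0 e0 - h'' (P \<rho> \<phi> \<theta>) e1 e1 - h'' (P \<rho> \<phi> \<theta>) e2 e2)"
      if "0 \<le> \<rho>" "\<rho> \<le> S" "0 \<le> \<phi>" "\<phi> \<le> pi / 2" "a\<^sup>2 \<le> g \<rho> \<phi>"
    proof -
      have "P \<rho> \<phi> \<theta> \<in> hyp_shell a b" using P_in that by blast
      then have "0 \<le> lorentz_trace (h'' (P \<rho> \<phi> \<theta>))" "bilinear (h'' (P \<rho> \<phi> \<theta>))"
        using pos C2_onD(8)[OF C2] by blast+
      moreover have "0 \<le> sin \<phi>" using that by (intro sin_ge_zero) auto
      ultimately show ?thesis
        using lorentz_trace_frame[of "h'' (P \<rho> \<phi> \<theta>)" k \<gamma> \<beta>] \<beta>\<gamma> k that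
        by (simp add: e0_def e1_def e2_def m_def)
    qed
    then show "0 \<le> indicat_real ({(\<rho>, \<phi>). 0 \<le> \<rho> \<and> \<rho> \<le> S \<and> 0 \<le> \<phi> \<and> \<phi> \<le> pi / 2 \<and> a\<^sup>2 \<le> g \<rho> \<phi>} \<times> {0..2 * pi}) x *\<^sub>R
        (case x of ((\<rho>, \<phi>), \<theta>) \<Rightarrow> \<rho> * sin \<phi> *
          (h'' (P \<rho> \<phi> \<theta>) e0 e0 - h'' (P \<rho> \<phi> \<theta>) e1 e1 - h'' (P \<rho> \<phi> \<theta>) e2 e2))"
      by (auto simp: x indicator_def)
  qed
  finally show ?thesis using pi_gt_zero by (simp add: zero_le_mult_iff)
qed

section \<open>Calculus for the d'Alembertian\<close>

lemma C2_onI: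
  assumes "\<And>p. p \<in> S \<Longrightarrow> (f has_derivative f' p) (at p within S)"
    and "\<And>p a. p \<in> S \<Longrightarrow> ((\<lambda>q. f' q a) has_derivative f'' p a) (at p within S)"
    and "\<And>p b. p \<in> S \<Longrightarrow> linear (\<lambda>a. f'' p a b)"
    and "\<And>a b. continuous_on S (\<lambda>p. f'' p a b)"
  shows "C2_on S f f' f''"
  using assms by (simp add: C2_on_def)

lemma C2_on_subset:
  assumes "C2_on S f f' f''" "T \<subseteq> S"
  shows "C2_on T f f' f''"
  using assms unfolding C2_on_def by (blast intro: has_derivative_subset continuous_on_subset)

text \<open>The second-order chain rule that supplies the Hessians of products and of the
  supersolutions, which are functions of two scalars such as t and s. Using \<open>G12\<close> in
  the derivatives of both \<open>G1\<close> and \<open>G2\<close> encodes the equality of mixed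
  partials; lower-order terms are continuous because they are differentiable.\<close>

lemma C2_on_compose2:
  fixes \<alpha> \<beta> :: "'a::euclidean_space \<Rightarrow> real"
  assumes \<alpha>: "C2_on S \<alpha> \<alpha>' \<alpha>''" and \<beta>: "C2_on S \<beta> \<beta>' \<beta>''"
    and R: "\<And>p. p \<in> S \<Longrightarrow> (\<alpha> p, \<beta> p) \<in> R"
    and G: "\<And>x y. (x, y) \<in> R \<Longrightarrow>
        ((\<lambda>z. G (fst z) (snd z)) has_derivative (\<lambda>h. G1 x y * fst h + G2 x y * snd h)) (at (x, y))"
    and G1: "\<And>x y. (x, y) \<in> R \<Longrightarrow>
        ((\<lambda>z. G1 (fst z) (snd z)) has_derivative (\<lambda>h. G11 x y * fst h + G12 x y * snd h)) (at (x, y))"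
    and G2: "\<And>x y. (x, y) \<in> R \<Longrightarrow>
        ((\<lambda>z. G2 (fst z) (snd z)) has_derivative (\<lambda>h. G12 x y * fst h + G22 x y * snd h)) (at (x, y))"
    and cont: "continuous_on R (\<lambda>z. G11 (fst z) (snd z))" "continuous_on R (\<lambda>z. G12 (fst z) (snd z))"
      "continuous_on R (\<lambda>z. G22 (fst z) (snd z))"
  shows "C2_on S (\<lambda>p. G (\<alpha> p) (\<beta> p)) (\<lambda>p a. G1 (\<alpha> p) (\<beta> p) * \<alpha>' p a + G2 (\<alpha> p) (\<beta> p) * \<beta>' p a)
    (\<lambda>p a b. G11 (\<alpha> p) (\<beta> p) * (\<alpha>' p a * \<alpha>' p b)
      + G12 (\<alpha> p) (\<beta> p) * (\<alpha>' p a * \<beta>' p b + \<beta>' p a * \<alpha>' p b)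
      + G22 (\<alpha> p) (\<beta> p) * (\<beta>' p a * \<beta>' p b)
      + G1 (\<alpha> p) (\<beta> p) * \<alpha>'' p a b + G2 (\<alpha> p) (\<beta> p) * \<beta>'' p a b)"
proof -
  have chain: "((\<lambda>p. H (\<alpha> p) (\<beta> p)) has_derivative
      (\<lambda>b. H1 (\<alpha> p) (\<beta> p) * \<alpha>' p b + H2 (\<alpha> p) (\<beta> p) * \<beta>' p b)) (at p within S)"
    if "p \<in> S" and H: "\<And>x y. (x, y) \<in> R \<Longrightarrow>
        ((\<lambda>z. H (fst z) (snd z)) has_derivative (\<lambda>h. H1 x y * fst h + H2 x y * snd h)) (at (x, y))"
    for H H1 H2 p
    using has_derivative_compose[OF has_derivative_Pair[OF C2_onD(1)[OF \<alpha> that(1)] C2_onD(1)[OF \<beta> that(1)]]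
        H[OF R[OF that(1)]]] by simp
  have comp: "continuous_on S (\<lambda>p. H (\<alpha> p) (\<beta> p))"
    if "continuous_on R (\<lambda>z. H (fst z) (snd z))" for H
  proof -
    have "continuous_on S (\<lambda>p. (\<alpha> p, \<beta> p))"
      by (intro continuous_intros C2_onD(6)[OF \<alpha>] C2_onD(6)[OF \<beta>])
    from continuous_on_compose2[OF that this] R show ?thesis by auto
  qed
  have contG: "continuous_on R (\<lambda>z. H (fst z) (snd z))"
    if "\<And>x y. (x, y) \<in> R \<Longrightarrow>
      ((\<lambda>z. H (fst z) (snd z)) has_derivative (\<lambda>h. H1 x y * fst h + H2 x y * snd h)) (at (x, y))"
    for H H1 H2
    by (rule has_derivative_continuous_on[where f'="\<lambda>(x, y) h. H1 x y * fst h + H2 x y * snd h"])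
      (auto intro: has_derivative_at_withinI that)
  note c = comp[OF cont(1)] comp[OF cont(2)] comp[OF cont(3)] comp[OF contG[OF G1]] comp[OF contG[OF G2]]
  show ?thesis
  proof (rule C2_onI)
    fix p assume p: "p \<in> S"
    show "((\<lambda>p. G (\<alpha> p) (\<beta> p)) has_derivative
        (\<lambda>a. G1 (\<alpha> p) (\<beta> p) * \<alpha>' p a + G2 (\<alpha> p) (\<beta> p) * \<beta>' p a)) (at p within S)"
      by (rule chain[OF p G])
    show "((\<lambda>p. G1 (\<alpha> p) (\<beta> p) * \<alpha>' p a + G2 (\<alpha> p) (\<beta> p) * \<beta>' p a) has_derivative
      (\<lambda>b. G11 (\<alpha> p) (\<beta> p) * (\<alpha>' p a * \<alpha>' p b)
      + G12 (\<alpha> p) (\<beta> p) * (\<alpha>' p a * \<beta>' p b + \<beta>' p a * \<alpha>' p b)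
      + G22 (\<alpha> p) (\<beta> p) * (\<beta>' p a * \<beta>' p b)
      + G1 (\<alpha> p) (\<beta> p) * \<alpha>'' p a b + G2 (\<alpha> p) (\<beta> p) * \<beta>'' p a b)) (at p within S)" for a
      by (rule has_derivative_eq_rhs[OF has_derivative_add[OF
            has_derivative_mult[OF chain[OF p G1] C2_onD(2)[OF \<alpha> p]]
            has_derivative_mult[OF chain[OF p G2] C2_onD(2)[OF \<beta> p]]]])
        (auto simp: algebra_simps)
    show "linear (\<lambda>a. G11 (\<alpha> p) (\<beta> p) * (\<alpha>' p a * \<alpha>' p b)
      + G12 (\<alpha> p) (\<beta> p) * (\<alpha>' p a * \<beta>' p b + \<beta>' p a * \<alpha>' p b)
      + G22 (\<alpha> p) (\<beta> p) * (\<beta>' p a * \<beta>' p b)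
      + G1 (\<alpha> p) (\<beta> p) * \<alpha>'' p a b + G2 (\<alpha> p) (\<beta> p) * \<beta>'' p a b)" for b
      using C2_onD(3,7)[OF \<alpha> p, THEN linear_add] C2_onD(3,7)[OF \<beta> p, THEN linear_add]
        C2_onD(3,7)[OF \<alpha> p, THEN linear_scale] C2_onD(3,7)[OF \<beta> p, THEN linear_scale]
      by (intro linearI) (simp_all add: algebra_simps)
  next
    show "continuous_on S (\<lambda>p. G11 (\<alpha> p) (\<beta> p) * (\<alpha>' p a * \<alpha>' p b)
      + G12 (\<alpha> p) (\<beta> p) * (\<alpha>' p a * \<beta>' p b + \<beta>' p a * \<alpha>' p b)
      + G22 (\<alpha> p) (\<beta> p) * (\<beta>' p a * \<beta>' p b)
      + G1 (\<alpha> p) (\<beta> p) * \<alpha>'' p a b + G2 (\<alpha> p) (\<beta> p) * \<beta>'' p a b)" for a b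
      by (intro continuous_intros c C2_onD(4,5)[OF \<alpha>] C2_onD(4,5)[OF \<beta>])
  qed
qed

lemma C2_on_compose:
  fixes \<alpha> :: "'a::euclidean_space \<Rightarrow> real"
  assumes \<alpha>: "C2_on S \<alpha> \<alpha>' \<alpha>''" and R: "\<And>p. p \<in> S \<Longrightarrow> \<alpha> p \<in> R"
    and g: "\<And>x. x \<in> R \<Longrightarrow> (g has_real_derivative g1 x) (at x)"
    and g1: "\<And>x. x \<in> R \<Longrightarrow> (g1 has_real_derivative g2 x) (at x)"
    and cont: "continuous_on R g2"
  shows "C2_on S (\<lambda>p. g (\<alpha> p)) (\<lambda>p a. g1 (\<alpha> p) * \<alpha>' p a)
    (\<lambda>p a b. g2 (\<alpha> p) * (\<alpha>' p a * \<alpha>' p b) + g1 (\<alpha> p) * \<alpha>'' p a b)"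
proof -
  have d: "((\<lambda>z. h (fst z)) has_derivative (\<lambda>k. h1 x * fst k + 0 * snd k)) (at (x, y))"
    if "(h has_real_derivative h1 x) (at x)" for h h1 and x y :: real
  proof -
    have "(h has_derivative (*) (h1 x)) (at (fst (x, y)))"
      using that by (simp add: has_field_derivative_def)
    from has_derivative_compose[OF has_derivative_fst[OF has_derivative_ident] this]
    show ?thesis by simp
  qed
  have "C2_on S (\<lambda>p. g (\<alpha> p)) (\<lambda>p a. g1 (\<alpha> p) * \<alpha>' p a + 0 * \<alpha>' p a)
    (\<lambda>p a b. g2 (\<alpha> p) * (\<alpha>' p a * \<alpha>' p b) + 0 * (\<alpha>' p a * \<alpha>' p b + \<alpha>' p a * \<alpha>' p b)
      + 0 * (\<alpha>' p a * \<alpha>' p b) + g1 (\<alpha> p) * \<alpha>'' p a b + 0 * \<alpha>'' p a b)"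
  proof (rule C2_on_compose2[OF \<alpha> \<alpha>, where R="R \<times> UNIV" and G="\<lambda>x _. g x" and ?G1.0="\<lambda>x _. g1 x"
        and ?G2.0="\<lambda>_ _. 0" and ?G11.0="\<lambda>x _. g2 x" and ?G12.0="\<lambda>_ _. 0" and ?G22.0="\<lambda>_ _. 0"])
    show "continuous_on (R \<times> UNIV) (\<lambda>z. g2 (fst z))"
      by (rule continuous_on_compose2[OF cont]) (auto intro: continuous_intros)
  next
    show "((\<lambda>z. g (fst z)) has_derivative (\<lambda>h. g1 x * fst h + 0 * snd h)) (at (x, y))"
      if "(x, y) \<in> R \<times> UNIV" for x y
      by (rule d, rule g) (use that in simp)
    show "((\<lambda>z. g1 (fst z)) has_derivative (\<lambda>h. g2 x * fst h + 0 * snd h)) (at (x, y))"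
      if "(x, y) \<in> R \<times> UNIV" for x y
      by (rule d, rule g1) (use that in simp)
  qed (use R in auto)
  then show ?thesis by simp
qed

lemma C2_on_add:
  assumes "C2_on S f f' f''" "C2_on S g g' g''"
  shows "C2_on S (\<lambda>p. f p + g p) (\<lambda>p a. f' p a + g' p a) (\<lambda>p a b. f'' p a b + g'' p a b)"
  using C2_onD(1-4)[OF assms(1)] C2_onD(1-4)[OF assms(2)]
  by (intro C2_onI has_derivative_add continuous_on_add linear_compose_add)

lemma C2_on_cmult:
  assumes "C2_on S f f' f''"
  shows "C2_on S (\<lambda>p. c * f p) (\<lambda>p a. c * f' p a) (\<lambda>p a b. c * f'' p a b)"
  using C2_on_compose[OF assms, where R=UNIV and g="\<lambda>x. c * x" and ?g1.0="\<lambda>_. c" and ?g2.0="\<lambda>_. 0"]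
  by (auto intro!: derivative_eq_intros)

lemma C2_on_mult:
  assumes "C2_on S f f' f''" "C2_on S g g' g''"
  shows "C2_on S (\<lambda>p. f p * g p) (\<lambda>p a. g p * f' p a + f p * g' p a)
    (\<lambda>p a b. f' p a * g' p b + g' p a * f' p b + g p * f'' p a b + f p * g'' p a b)"
proof -
  have "((\<lambda>z :: real \<times> real. fst z * snd z) has_derivative (\<lambda>h. y * fst h + x * snd h)) (at (x, y))" for x y
    by (auto intro!: derivative_eq_intros simp: mult.commute)
  with C2_on_compose2[OF assms, where R=UNIV and G="\<lambda>x y. x * y" and ?G1.0="\<lambda>x y. y"
        and ?G2.0="\<lambda>x y. x" and ?G11.0="\<lambda>_ _. 0" and ?G12.0="\<lambda>_ _. 1" and ?G22.0="\<lambda>_ _. 0"]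
  show ?thesis
    by (simp add: has_derivative_fst has_derivative_snd mult.commute)
qed

lemma C2_on_linear:
  assumes "bounded_linear f"
  shows "C2_on S f (\<lambda>_. f) (\<lambda>_ _ _. 0)"
  using bounded_linear_imp_has_derivative[OF assms] by (intro C2_onI) (auto intro!: linearI)

lemma C2_on_lorentz_sq:
  "C2_on S lorentz_sq (\<lambda>p a. 2 * (fst p * fst a - snd p \<bullet> snd a))
    (\<lambda>p a b. 2 * (fst a * fst b - snd a \<bullet> snd b))"
proof (rule C2_onI)
  show "(lorentz_sq has_derivative (\<lambda>a. 2 * (fst p * fst a - snd p \<bullet> snd a))) (at p within S)" for p
    unfolding lorentz_sq_def[abs_def] power2_norm_eq_inner
    by (auto intro!: derivative_eq_intros simp: inner_commute algebra_simps)
qed (auto intro!: derivative_eq_intros linearI simp: algebra_simps inner_add_left inner_commute)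


abbreviation lorentz_grad :: "(spacetime \<Rightarrow> real) \<Rightarrow> (spacetime \<Rightarrow> real) \<Rightarrow> real" where
  "lorentz_grad f g \<equiv> lorentz_trace (\<lambda>a b. f a * g b)"

lemma lorentz_trace_linear:
  "lorentz_trace (\<lambda>a b. B a b + B' a b) = lorentz_trace B + lorentz_trace B'"
  "lorentz_trace (\<lambda>a b. c * B a b) = c * lorentz_trace B"
  by (simp_all add: lorentz_trace_def sum.distrib sum_distrib_left algebra_simps)

lemma lorentz_grad_commute: "lorentz_grad f g = lorentz_grad g f"
  by (simp add: lorentz_trace_def mult.commute)

lemma basis_simps [simp]:
  "fst e_t = 1" "snd e_t = 0" "fst (e_x i) = 0" "snd (e_x i) = axis i 1"
  by (simp_all add: e_t_def e_x_def)

lemma lorentz_trace_lorentz_sq: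
  "lorentz_grad fst fst = 1"
  "lorentz_grad fst (\<lambda>a. 2 * (fst p * fst a - snd p \<bullet> snd a)) = 2 * fst p"
  "lorentz_grad (\<lambda>a. 2 * (fst p * fst a - snd p \<bullet> snd a)) (\<lambda>a. 2 * (fst p * fst a - snd p \<bullet> snd a))
    = 4 * lorentz_sq p"
  "lorentz_trace (\<lambda>a b. 2 * (fst a * fst b - snd a \<bullet> snd b)) = 6"
proof -
  show "lorentz_grad (\<lambda>a. 2 * (fst p * fst a - snd p \<bullet> snd a)) (\<lambda>a. 2 * (fst p * fst a - snd p \<bullet> snd a))
    = 4 * lorentz_sq p"
    unfolding lorentz_sq_def power2_norm_eq_inner
    by (simp add: lorentz_trace_def inner_axis sum_2 inner_vec_def[of "snd p" "snd p"] power2_eq_square algebra_simps)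
qed (simp_all add: lorentz_trace_def inner_axis_axis inner_axis sum_2)

section \<open>Supersolutions\<close>

text \<open>The left side has the shape of the Hessian in \<open>C2_on_compose2\<close>, so the
  d'Alembertian of a function of two scalars reduces to their gradient products and
  d'Alembertians.\<close>

lemma lorentz_trace_compose2:
  "lorentz_trace (\<lambda>a b. c11 * (f a * f b) + c12 * (f a * g b + g a * f b) + c22 * (g a * g b)
      + c1 * A a b + c2 * B a b)
    = c11 * lorentz_grad f f + 2 * c12 * lorentz_grad f g + c22 * lorentz_grad g g
      + c1 * lorentz_trace A + c2 * lorentz_trace B"
  by (simp add: lorentz_trace_linear lorentz_grad_commute[of g f])

lemma lorentz_trace_compose:
  "lorentz_trace (\<lambda>a b. c11 * (f a * f b) + c1 * A a b) = c11 * lorentz_grad f f + c1 * lorentz_trace A"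
  by (simp add: lorentz_trace_linear)

lemma lorentz_grad_scale:
  "lorentz_grad f (\<lambda>a. c * g a) = c * lorentz_grad f g"
  "lorentz_grad (\<lambda>a. c * f a) g = c * lorentz_grad f g"
  by (simp_all add: lorentz_trace_def sum_distrib_left algebra_simps)

lemma hyp_shell_bounds:
  assumes "p \<in> hyp_shell a b" "0 \<le> a"
  defines "s \<equiv> sqrt (lorentz_sq p)"
  shows "a \<le> s" "s \<le> fst p" "s\<^sup>2 = lorentz_sq p"
proof -
  have *: "0 < fst p" "a\<^sup>2 \<le> lorentz_sq p" using assms by (auto simp: hyp_shell_def)
  then show "a \<le> s" unfolding s_def by (intro real_le_rsqrt) auto
  have "0 \<le> lorentz_sq p" using * zero_le_power2[of a] by linarith
  then show "s\<^sup>2 = lorentz_sq p" by (simp add: s_def)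
  show "s \<le> fst p" unfolding s_def
    using * by (intro real_le_lsqrt) (auto simp: lorentz_sq_def)
qed

text \<open>Proper time is Minkowski distance from the origin, so its gradient is the unit radial
  vector. The 2 in its d'Alembertian is the dimension of the hyperboloids.\<close>

lemma proper_time_C2:
  assumes "0 < a"
  obtains s' s'' where
    "C2_on (hyp_shell a b) (\<lambda>p. sqrt (lorentz_sq p)) s' s''"
    "\<And>p. p \<in> hyp_shell a b \<Longrightarrow> lorentz_grad fst (s' p) = fst p / sqrt (lorentz_sq p)"
    "\<And>p. p \<in> hyp_shell a b \<Longrightarrow> lorentz_grad (s' p) (s' p) = 1"
    "\<And>p. p \<in> hyp_shell a b \<Longrightarrow> lorentz_trace (s'' p) = 2 / sqrt (lorentz_sq p)"
proof -
  note C2 = C2_on_compose[where R="{0<..}" and g=sqrt and ?g1.0="\<lambda>x. 1 / (2 * sqrt x)"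
      and ?g2.0="\<lambda>x. - 1 / (4 * x * sqrt x)", OF C2_on_lorentz_sq[of "hyp_shell a b"]]
  have pos: "0 < lorentz_sq p" if "p \<in> hyp_shell a b" for p
    using that zero_less_power[OF assms, of 2] unfolding hyp_shell_def mem_Collect_eq by linarith
  have sq: "sqrt (lorentz_sq p) * sqrt (lorentz_sq p) = lorentz_sq p" if "p \<in> hyp_shell a b" for p
    using pos[OF that] by simp
  show ?thesis
  proof (rule that, rule C2)
    show "(sqrt has_real_derivative 1 / (2 * sqrt x)) (at x)" if "x \<in> {0<..}" for x
      using that by (auto intro!: derivative_eq_intros simp: field_simps)
    show "((\<lambda>x. 1 / (2 * sqrt x)) has_real_derivative - 1 / (4 * x * sqrt x)) (at x)" if "x \<in> {0<..}" for x
      using that by (auto intro!: derivative_eq_intros simp: field_simps)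
    show "continuous_on {0<..} (\<lambda>x. - 1 / (4 * x * sqrt x) :: real)"
      by (intro continuous_intros) auto
  next
    fix p assume p: "p \<in> hyp_shell a b"
    show "lorentz_sq p \<in> {0<..}" using pos[OF p] by simp
    show "lorentz_grad fst (\<lambda>a. 1 / (2 * sqrt (lorentz_sq p)) * (2 * (fst p * fst a - snd p \<bullet> snd a)))
        = fst p / sqrt (lorentz_sq p)"
      unfolding lorentz_grad_scale(1)[of fst "1 / (2 * sqrt (lorentz_sq p))"] lorentz_trace_lorentz_sq by simp
    show "lorentz_grad (\<lambda>a. 1 / (2 * sqrt (lorentz_sq p)) * (2 * (fst p * fst a - snd p \<bullet> snd a)))
        (\<lambda>a. 1 / (2 * sqrt (lorentz_sq p)) * (2 * (fst p * fst a - snd p \<bullet> snd a))) = 1"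
      unfolding lorentz_grad_scale(1)[of _ "1 / (2 * sqrt (lorentz_sq p))"]
        lorentz_grad_scale(2)[of "1 / (2 * sqrt (lorentz_sq p))"] lorentz_trace_lorentz_sq
      using pos[OF p] sq[OF p] by (simp add: field_simps)
    show "lorentz_trace (\<lambda>a b. - 1 / (4 * lorentz_sq p * sqrt (lorentz_sq p)) *
        (2 * (fst p * fst a - snd p \<bullet> snd a) * (2 * (fst p * fst b - snd p \<bullet> snd b)))
        + 1 / (2 * sqrt (lorentz_sq p)) * (2 * (fst a * fst b - snd a \<bullet> snd b)))
      = 2 / sqrt (lorentz_sq p)"
      unfolding lorentz_trace_compose lorentz_trace_lorentz_sq
      using pos[OF p] by (simp add: field_simps)
  qed
qed

text \<open>In hyperbolic coordinates \<open>t = s c\<close> the function \<open>1 / (1 + c) = s / (s + t)\<close> is a static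
  supersolution whose source is comparable to \<open>t\<^sup>-\<^sup>2\<close>; the factor \<open>(1 - 2 / s)\<^sup>2\<close> gives it zero
  Cauchy data on \<open>s = 2\<close> without making the source negative.\<close>

lemma supersolution_inverse_square:
  obtains v v' v'' where
    "C2_on (hyp_shell 2 b) v v' v''"
    "\<And>p. p \<in> hyp_shell 2 b \<Longrightarrow> lorentz_sq p = 2\<^sup>2 \<Longrightarrow> v p = 0"
    "\<And>p a. p \<in> hyp_shell 2 b \<Longrightarrow> lorentz_sq p = 2\<^sup>2 \<Longrightarrow> v' p a = 0"
    "\<And>p. p \<in> hyp_shell 2 b \<Longrightarrow> 1 / (4 * (fst p)\<^sup>2) \<le> lorentz_trace (v'' p)"
    "\<And>p. p \<in> hyp_shell 2 b \<Longrightarrow> v p \<le> sqrt (lorentz_sq p) / fst p"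
proof -
  let ?S = "hyp_shell 2 b"
  define s where "s = (\<lambda>p. sqrt (lorentz_sq p))"
  obtain s' s'' where s: "C2_on ?S s s' s''"
    "\<And>p. p \<in> ?S \<Longrightarrow> lorentz_grad fst (s' p) = fst p / s p"
    "\<And>p. p \<in> ?S \<Longrightarrow> lorentz_grad (s' p) (s' p) = 1"
    "\<And>p. p \<in> ?S \<Longrightarrow> lorentz_trace (s'' p) = 2 / s p"
    unfolding s_def using proper_time_C2[of 2 b] by auto
  have bounds: "2 \<le> s p" "s p \<le> fst p" "(s p)\<^sup>2 = lorentz_sq p" if "p \<in> ?S" for p
    unfolding s_def using hyp_shell_bounds[OF that] by auto
  \<comment> \<open>With the two inverses named and given their own derivative rules,
    \<open>G\<close> and its partials become polynomials. The factor
    \<open>s - 4 + 4 * \<kappa> t s\<close> is (s - 2)^2 / s expanded.\<close>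
  define \<kappa> :: "real \<Rightarrow> real \<Rightarrow> real" where "\<kappa> = (\<lambda>t s. inverse s)"
  define \<delta> :: "real \<Rightarrow> real \<Rightarrow> real" where "\<delta> = (\<lambda>t s. inverse (s + t))"
  define G where "G = (\<lambda>t s. (s - 4 + 4 * \<kappa> t s) * \<delta> t s)"
  define G1 where "G1 = (\<lambda>t s. - (s - 4 + 4 * \<kappa> t s) * (\<delta> t s)\<^sup>2)"
  define G2 where "G2 = (\<lambda>t s. (1 - 4 * (\<kappa> t s)\<^sup>2) * \<delta> t s - (s - 4 + 4 * \<kappa> t s) * (\<delta> t s)\<^sup>2)"
  define G11 where "G11 = (\<lambda>t s. 2 * (s - 4 + 4 * \<kappa> t s) * \<delta> t s ^ 3)"
  define G12 where
    "G12 = (\<lambda>t s. - (1 - 4 * (\<kappa> t s)\<^sup>2) * (\<delta> t s)\<^sup>2 + 2 * (s - 4 + 4 * \<kappa> t s) * \<delta> t s ^ 3)"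
  define G22 where
    "G22 = (\<lambda>t s. 8 * \<kappa> t s ^ 3 * \<delta> t s - 2 * (1 - 4 * (\<kappa> t s)\<^sup>2) * (\<delta> t s)\<^sup>2
      + 2 * (s - 4 + 4 * \<kappa> t s) * \<delta> t s ^ 3)"
  note defs = G_def G1_def G2_def G11_def G12_def G22_def
  define R :: "(real \<times> real) set" where "R = {0<..} \<times> {0<..}"
  have \<delta>: "((\<lambda>z. \<delta> (fst z) (snd z)) has_derivative (\<lambda>h. - (\<delta> x y)\<^sup>2 * (fst h + snd h))) (at (x, y))"
    and \<kappa>: "((\<lambda>z. \<kappa> (fst z) (snd z)) has_derivative (\<lambda>h. - (\<kappa> x y)\<^sup>2 * snd h)) (at (x, y))"
    if "(x, y) \<in> R" for x y :: real
    using that unfolding R_def \<delta>_def \<kappa>_def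
    by (auto intro!: derivative_eq_intros simp: power2_eq_square algebra_simps)
  have C2: "C2_on ?S (\<lambda>p. G (fst p) (s p)) (\<lambda>p a. G1 (fst p) (s p) * fst a + G2 (fst p) (s p) * s' p a)
    (\<lambda>p a b. G11 (fst p) (s p) * (fst a * fst b)
      + G12 (fst p) (s p) * (fst a * s' p b + s' p a * fst b)
      + G22 (fst p) (s p) * (s' p a * s' p b)
      + G1 (fst p) (s p) * 0 + G2 (fst p) (s p) * s'' p a b)"
  proof (rule C2_on_compose2[OF C2_on_linear[OF bounded_linear_fst] s(1), where R=R])
    show "(fst p, s p) \<in> R" if "p \<in> ?S" for p
      using bounds[OF that] by (simp add: R_def)
    have ne: "snd z + fst z \<noteq> 0" "snd z \<noteq> 0" if "z \<in> R" for z
      using that by (auto simp: R_def)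
    show "continuous_on R (\<lambda>z. G11 (fst z) (snd z))" "continuous_on R (\<lambda>z. G12 (fst z) (snd z))"
      "continuous_on R (\<lambda>z. G22 (fst z) (snd z))"
      unfolding defs \<delta>_def \<kappa>_def using ne by (auto intro!: continuous_intros)
  next
    fix x y :: real assume "(x, y) \<in> R"
    note d = derivative_eq_intros \<delta>[OF this] \<kappa>[OF this] refl
    show "((\<lambda>z. G (fst z) (snd z)) has_derivative (\<lambda>h. G1 x y * fst h + G2 x y * snd h)) (at (x, y))"
      unfolding defs by (rule d)+ (simp add: algebra_simps power2_eq_square power3_eq_cube)
    show "((\<lambda>z. G1 (fst z) (snd z)) has_derivative (\<lambda>h. G11 x y * fst h + G12 x y * snd h)) (at (x, y))"
      unfolding defs by (rule d)+ (simp add: algebra_simps power2_eq_square power3_eq_cube)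
    show "((\<lambda>z. G2 (fst z) (snd z)) has_derivative (\<lambda>h. G12 x y * fst h + G22 x y * snd h)) (at (x, y))"
      unfolding defs by (rule d)+ (simp add: algebra_simps power2_eq_square power3_eq_cube)
  qed
  show ?thesis
  proof (rule that[OF C2])
    fix p assume p: "p \<in> ?S"
    note b = bounds[OF p]
    {
      assume "lorentz_sq p = 2\<^sup>2"
      then have "s p = 2" by (simp add: s_def)
      then show "G (fst p) (s p) = 0" "G1 (fst p) (s p) * fst a + G2 (fst p) (s p) * s' p a = 0" for a
        by (simp_all add: defs \<kappa>_def power2_eq_square)
    }
    define S t D where "S = s p" and "t = fst p" and "D = s p + fst p"
    have SD: "2 \<le> S" "S \<le> t" "t = D - S" "0 < S" "0 < D" "S \<le> D" "D \<le> 2 * t"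
      using b by (auto simp: S_def t_def D_def)
    have "lorentz_trace (\<lambda>a b. G11 (fst p) (s p) * (fst a * fst b)
      + G12 (fst p) (s p) * (fst a * s' p b + s' p a * fst b)
      + G22 (fst p) (s p) * (s' p a * s' p b)
      + G1 (fst p) (s p) * 0 + G2 (fst p) (s p) * s'' p a b)
      = G11 t S + 2 * G12 t S * (t / S) + G22 t S + G2 t S * (2 / S)"
      unfolding lorentz_trace_compose2 using s(2-4)[OF p] lorentz_trace_lorentz_sq(1)
      by (simp add: S_def t_def lorentz_trace_def)
    \<comment> \<open>On functions of s the d'Alembertian is h'' + 2 h' / s. It kills 1 / s and
      sends 4 / s^2 to 8 / s^4, so the factor (1 - 2 / s)^2 contributes 8 / s^4 times s / D. The
      factor s / D itself has source 2 / D^2, and no cross term arises because it depends on t / s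
      only.\<close>
    also have "\<dots> = 2 * (S - 2)\<^sup>2 / (S\<^sup>2 * D\<^sup>2) + 8 / (S ^ 3 * D)"
    proof -
      define k d where "k = inverse S" and "d = inverse D"
      have kd: "S * k = 1" "D * d = 1" using SD by (simp_all add: k_def d_def)
      have "G11 t S + 2 * G12 t S * (t / S) + G22 t S + G2 t S * (2 / S)
          = 2 * (S - 2)\<^sup>2 * k\<^sup>2 * d\<^sup>2 + 8 * k ^ 3 * d"
        using kd unfolding defs \<delta>_def \<kappa>_def SD(3) divide_inverse
          add.commute[of S] diff_add_cancel k_def[symmetric] d_def[symmetric]
        by algebra
      then show ?thesis
        by (simp add: k_def d_def power_inverse divide_inverse)
    qed
    \<comment> \<open>The first term degenerates at S = 2 and the second fills the gap: over the
      common denominator, 2 (S - 2)^2 + 8 = S^2 + (S - 4)^2.\<close>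
    also have "\<dots> \<ge> 2 * (S - 2)\<^sup>2 / (S\<^sup>2 * D\<^sup>2) + 8 / (S\<^sup>2 * D\<^sup>2)"
    proof -
      have "S ^ 3 * D \<le> S\<^sup>2 * D\<^sup>2" using SD by (simp add: power2_eq_square power3_eq_cube)
      then show ?thesis using SD by (intro add_left_mono divide_left_mono) auto
    qed
    also have "2 * (S - 2)\<^sup>2 / (S\<^sup>2 * D\<^sup>2) + 8 / (S\<^sup>2 * D\<^sup>2) = (S\<^sup>2 + (S - 4)\<^sup>2) / (S\<^sup>2 * D\<^sup>2)"
      by (simp add: power2_eq_square algebra_simps flip: add_divide_distrib)
    also have "\<dots> \<ge> S\<^sup>2 / (S\<^sup>2 * D\<^sup>2)"
      by (intro divide_right_mono) auto
    also have "S\<^sup>2 / (S\<^sup>2 * D\<^sup>2) = 1 / D\<^sup>2" using SD by simp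
    also have "\<dots> \<ge> 1 / (4 * t\<^sup>2)"
    proof -
      have "D\<^sup>2 \<le> (2 * t)\<^sup>2" using SD(5,7) by (intro power_mono) auto
      then have "D\<^sup>2 \<le> 4 * t\<^sup>2" by (simp only: power_mult_distrib) simp
      then show ?thesis using SD by (intro divide_left_mono) auto
    qed
    finally show "1 / (4 * (fst p)\<^sup>2) \<le> lorentz_trace (\<lambda>a b. G11 (fst p) (s p) * (fst a * fst b)
      + G12 (fst p) (s p) * (fst a * s' p b + s' p a * fst b)
      + G22 (fst p) (s p) * (s' p a * s' p b)
      + G1 (fst p) (s p) * 0 + G2 (fst p) (s p) * s'' p a b)"
      by (simp add: t_def)
    have "S - 4 + 4 / S \<le> S" using SD by (simp add: field_simps)
    then have "(S - 4 + 4 / S) / D \<le> S / t"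
      using SD by (intro frac_le) auto
    then show "G (fst p) (s p) \<le> sqrt (lorentz_sq p) / fst p"
      by (simp add: G_def S_def t_def D_def s_def \<delta>_def \<kappa>_def divide_inverse)
  qed
qed

text \<open>\<open>N\<close> is the square of the conformal factor, with r = |x| equal to ((t - r)^2
  + 4) ((t + r)^2 + 4). The power -1/4 is the conformal weight in three space-time dimensions, and
  the last identity is the Yamabe equation with exponent 5, expressing that the Einstein cylinder
  has constant scalar curvature. Writing everything in powers of M =
  \<open>N p powr (- 1 / 4)\<close> leaves polynomial identities modulo N M^4 = 1.\<close>

lemma conformal_weight_C2:
  fixes S :: "spacetime set"
  defines "N \<equiv> \<lambda>p. (lorentz_sq p - 4)\<^sup>2 + 16 * (fst p)\<^sup>2"
  assumes pos: "\<And>p. p \<in> S \<Longrightarrow> 0 < fst p"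
  obtains M' M'' where
    "C2_on S (\<lambda>p. N p powr (- 1 / 4)) M' M''"
    "\<And>p a. p \<in> S \<Longrightarrow> M' p a = - 1 / 4 * (N p powr (- 1 / 4)) ^ 5 *
      (32 * fst p * fst a + 2 * (lorentz_sq p - 4) * (2 * (fst p * fst a - snd p \<bullet> snd a)))"
    "\<And>p. p \<in> S \<Longrightarrow> lorentz_grad fst (M' p) = - fst p * (lorentz_sq p + 4) * (N p powr (- 1 / 4)) ^ 5"
    "\<And>p. p \<in> S \<Longrightarrow> lorentz_grad (M' p) (M' p) = lorentz_sq p * (N p powr (- 1 / 4)) ^ 6"
    "\<And>p. p \<in> S \<Longrightarrow> lorentz_trace (M'' p) = 4 * (N p powr (- 1 / 4)) ^ 5"
proof -
  let ?Q' = "\<lambda>p a. 2 * (fst p * fst a - snd p \<bullet> snd a)"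
  let ?Q'' = "\<lambda>p a b. 2 * (fst a * fst b - snd a \<bullet> snd b)"
  define N' :: "spacetime \<Rightarrow> spacetime \<Rightarrow> real" where
    "N' = (\<lambda>p a. 32 * fst p * fst a + 2 * (lorentz_sq p - 4) * ?Q' p a)"
  define N'' :: "spacetime \<Rightarrow> spacetime \<Rightarrow> spacetime \<Rightarrow> real" where
    "N'' = (\<lambda>p a b. 32 * (fst a * fst b) + 0 * (fst a * ?Q' p b + ?Q' p a * fst b)
      + 2 * (?Q' p a * ?Q' p b) + 32 * fst p * 0 + 2 * (lorentz_sq p - 4) * ?Q'' p a b)"
  have N: "C2_on S N N' N''"
    unfolding N_def N'_def N''_def
    by (rule C2_on_compose2[OF C2_on_linear[OF bounded_linear_fst] C2_on_lorentz_sq, where R=UNIV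
          and G="\<lambda>t q. (q - 4)\<^sup>2 + 16 * t\<^sup>2" and ?G1.0="\<lambda>t q. 32 * t" and ?G2.0="\<lambda>t q. 2 * (q - 4)"
          and ?G11.0="\<lambda>_ _. 32" and ?G12.0="\<lambda>_ _. 0" and ?G22.0="\<lambda>_ _. 2"])
      (auto intro!: derivative_eq_intros)
  have tN: "lorentz_grad fst (N' p) = 4 * fst p * (lorentz_sq p + 4)" for p
  proof -
    have "lorentz_grad fst (N' p) = 32 * fst p * lorentz_grad fst fst + 2 * (lorentz_sq p - 4) * lorentz_grad fst (?Q' p)"
      by (simp add: N'_def lorentz_trace_def algebra_simps sum.distrib sum_distrib_left)
    then show ?thesis by (simp only: lorentz_trace_lorentz_sq) (simp add: algebra_simps)
  qed
  have NN: "lorentz_grad (N' p) (N' p) = 16 * lorentz_sq p * N p" for p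
  proof -
    have "lorentz_grad (N' p) (N' p) = (32 * fst p)\<^sup>2 * lorentz_grad fst fst
        + 2 * (32 * fst p * (2 * (lorentz_sq p - 4))) * lorentz_grad fst (?Q' p)
        + (2 * (lorentz_sq p - 4))\<^sup>2 * lorentz_grad (?Q' p) (?Q' p)
        + 0 * lorentz_trace (\<lambda>_ _. 0) + 0 * lorentz_trace (\<lambda>_ _. 0)"
      unfolding lorentz_trace_compose2[symmetric] N'_def
      by (intro arg_cong[where f=lorentz_trace] ext) (simp add: algebra_simps power2_eq_square)
    then show ?thesis
      by (simp only: lorentz_trace_lorentz_sq N_def) (simp add: algebra_simps power2_eq_square)
  qed
  have tr: "lorentz_trace (N'' p) = 20 * lorentz_sq p - 16" for p
  proof -
    have "lorentz_trace (\<lambda>_ _ :: spacetime. 0 :: real) = 0" by (simp add: lorentz_trace_def)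
    then show ?thesis
      by (simp only: N''_def lorentz_trace_compose2 lorentz_trace_lorentz_sq) (simp add: algebra_simps)
  qed
  have Npos: "0 < N p" if "p \<in> S" for p
    using pos[OF that] by (simp add: N_def add_nonneg_pos)
  have pw: "x powr (- 5 / 4) = (x powr (- 1 / 4)) ^ 5" "x powr (- 9 / 4) = (x powr (- 1 / 4)) ^ 9"
    if "x > 0" for x :: real
    using that by (simp_all add: powr_power)
  have N4: "N p * (N p powr (- 1 / 4)) ^ 4 = 1" if "p \<in> S" for p
    using Npos[OF that] by (subst powr_power) (auto simp: powr_minus)
  note M = C2_on_compose[OF N, where R="{0<..}" and g="\<lambda>x. x powr (- 1 / 4)"
      and ?g1.0="\<lambda>x. - (x powr (- 5 / 4)) / 4" and ?g2.0="\<lambda>x. 5 / 16 * x powr (- 9 / 4)"]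
  show ?thesis
  proof (rule that, rule M)
    show "((\<lambda>x. x powr (- 1 / 4)) has_real_derivative - (x powr (- 5 / 4)) / 4) (at x)"
      if "x \<in> {0<..}" for x :: real
      using that by (auto intro!: derivative_eq_intros)
    show "((\<lambda>x. - (x powr (- 5 / 4)) / 4) has_real_derivative 5 / 16 * x powr (- 9 / 4)) (at x)"
      if "x \<in> {0<..}" for x :: real
      using that by (auto intro!: derivative_eq_intros)
    show "continuous_on {0<..} (\<lambda>x :: real. 5 / 16 * x powr (- 9 / 4))"
      by (intro continuous_intros) auto
  next
    fix p assume p: "p \<in> S"
    show "N p \<in> {0<..}" using Npos[OF p] by simp
    show "- (N p powr (- 5 / 4)) / 4 * N' p a = - 1 / 4 * (N p powr (- 1 / 4)) ^ 5 *
      (32 * fst p * fst a + 2 * (lorentz_sq p - 4) * (2 * (fst p * fst a - snd p \<bullet> snd a)))" for a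
      using pw Npos[OF p] by (simp add: N'_def)
    show "lorentz_grad fst (\<lambda>a. - (N p powr (- 5 / 4)) / 4 * N' p a)
        = - fst p * (lorentz_sq p + 4) * (N p powr (- 1 / 4)) ^ 5"
      unfolding lorentz_grad_scale tN pw[OF Npos[OF p]] by simp
    show "lorentz_grad (\<lambda>a. - (N p powr (- 5 / 4)) / 4 * N' p a) (\<lambda>a. - (N p powr (- 5 / 4)) / 4 * N' p a)
        = lorentz_sq p * (N p powr (- 1 / 4)) ^ 6"
      unfolding lorentz_grad_scale NN pw[OF Npos[OF p]] using N4[OF p] by algebra
    show "lorentz_trace (\<lambda>a b. 5 / 16 * N p powr (- 9 / 4) * (N' p a * N' p b)
        + - (N p powr (- 5 / 4)) / 4 * N'' p a b) = 4 * (N p powr (- 1 / 4)) ^ 5"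
      unfolding lorentz_trace_compose NN tr pw[OF Npos[OF p]] using N4[OF p] by algebra
  qed
qed

text \<open>Under the conformal compactification of Minkowski space with factor
  \<open>\<Omega>\<^sup>2 = (s\<^sup>2 - 4)\<^sup>2 + 16 t\<^sup>2\<close> the hyperboloid \<open>s = 2\<close> becomes the slice \<open>T = \<pi> / 2\<close> of the Einstein
  cylinder, and \<open>\<Omega>\<^sup>-\<^sup>1\<^sup>/\<^sup>2 (1 - sin T)\<close> with \<open>sin T = 4 t / \<Omega>\<close> is a supersolution with zero Cauchy
  data there.\<close>

lemma supersolution_decaying:
  obtains v v' v'' where
    "C2_on (hyp_shell 2 b) v v' v''"
    "\<And>p. p \<in> hyp_shell 2 b \<Longrightarrow> lorentz_sq p = 2\<^sup>2 \<Longrightarrow> v p = 0"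
    "\<And>p a. p \<in> hyp_shell 2 b \<Longrightarrow> lorentz_sq p = 2\<^sup>2 \<Longrightarrow> v' p a = 0"
    "\<And>p. p \<in> hyp_shell 2 b \<Longrightarrow>
      4 * ((fst p) ^ 4 + 16 * (fst p)\<^sup>2) powr (- 5 / 4) \<le> lorentz_trace (v'' p)"
    "\<And>p. p \<in> hyp_shell 2 b \<Longrightarrow> v p \<le> 1 / sqrt (lorentz_sq p)"
proof -
  let ?S = "hyp_shell 2 b"
  define N where "N = (\<lambda>p :: spacetime. (lorentz_sq p - 4)\<^sup>2 + 16 * (fst p)\<^sup>2)"
  define M where "M = (\<lambda>p. N p powr (- 1 / 4))"
  have t: "0 < fst p" "4 \<le> lorentz_sq p" if "p \<in> ?S" for p
    using that by (auto simp: hyp_shell_def)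
  obtain M' M'' where M: "C2_on ?S M M' M''"
    "\<And>p a. p \<in> ?S \<Longrightarrow> M' p a = - 1 / 4 * M p ^ 5 *
      (32 * fst p * fst a + 2 * (lorentz_sq p - 4) * (2 * (fst p * fst a - snd p \<bullet> snd a)))"
    "\<And>p. p \<in> ?S \<Longrightarrow> lorentz_grad fst (M' p) = - fst p * (lorentz_sq p + 4) * M p ^ 5"
    "\<And>p. p \<in> ?S \<Longrightarrow> lorentz_grad (M' p) (M' p) = lorentz_sq p * M p ^ 6"
    "\<And>p. p \<in> ?S \<Longrightarrow> lorentz_trace (M'' p) = 4 * M p ^ 5"
    unfolding M_def N_def using conformal_weight_C2[of ?S] t(1) by blast
  have Npos: "0 < N p" if "p \<in> ?S" for p
    using t[OF that] by (simp add: N_def add_nonneg_pos)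
  have Mpos: "0 < M p" if "p \<in> ?S" for p
    using Npos[OF that] by (simp add: M_def)
  have M4: "N p * M p ^ 4 = 1" if "p \<in> ?S" for p
    using Npos[OF that] unfolding M_def by (subst powr_power) (auto simp: powr_minus)
  \<comment> \<open>As M^2 is the inverse conformal factor, 4 t M^2 is sin T, and the function is M
    (1 - sin T).\<close>
  have C2: "C2_on ?S (\<lambda>p. M p - 4 * fst p * M p ^ 3)
      (\<lambda>p a. - 4 * M p ^ 3 * fst a + (1 - 12 * fst p * (M p)\<^sup>2) * M' p a)
      (\<lambda>p a b. 0 * (fst a * fst b) + - 12 * (M p)\<^sup>2 * (fst a * M' p b + M' p a * fst b)
        + - 24 * fst p * M p * (M' p a * M' p b) + - 4 * M p ^ 3 * 0
        + (1 - 12 * fst p * (M p)\<^sup>2) * M'' p a b)"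
    by (rule C2_on_compose2[OF C2_on_linear[OF bounded_linear_fst] M(1), where R=UNIV
          and G="\<lambda>t m. m - 4 * t * m ^ 3" and ?G1.0="\<lambda>t m. - 4 * m ^ 3" and ?G2.0="\<lambda>t m. 1 - 12 * t * m\<^sup>2"
          and ?G11.0="\<lambda>_ _. 0" and ?G12.0="\<lambda>t m. - 12 * m\<^sup>2" and ?G22.0="\<lambda>t m. - 24 * t * m"])
      (auto intro!: derivative_eq_intros continuous_intros simp: algebra_simps)
  show ?thesis
  proof (rule that[OF C2])
    fix p assume p: "p \<in> ?S"
    note tp = t[OF p] and Mp = Mpos[OF p]
    {
      assume 4: "lorentz_sq p = 2\<^sup>2"
      \<comment> \<open>On s = 2 one has N = 16 t^2, that is, sin T = 1. This is the maximum of
        sine, so 1 - sin T vanishes there together with its gradient.\<close>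
      then have "(4 * fst p * (M p)\<^sup>2)\<^sup>2 = 1\<^sup>2"
        using M4[OF p] by (simp add: N_def power_mult_distrib mult.assoc flip: power_mult)
      then have *: "4 * fst p * (M p)\<^sup>2 = 1"
        using tp Mp by (subst (asm) power2_eq_iff_nonneg) auto
      then show "M p - 4 * fst p * M p ^ 3 = 0" by algebra
      show "- 4 * M p ^ 3 * fst a + (1 - 12 * fst p * (M p)\<^sup>2) * M' p a = 0" for a
      proof -
        have "M' p a = - 8 * M p ^ 5 * fst p * fst a" using M(2)[OF p] 4 by simp
        then show ?thesis using * by algebra
      qed
    }
    have "lorentz_trace (\<lambda>a b. 0 * (fst a * fst b) + - 12 * (M p)\<^sup>2 * (fst a * M' p b + M' p a * fst b)
        + - 24 * fst p * M p * (M' p a * M' p b) + - 4 * M p ^ 3 * 0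
        + (1 - 12 * fst p * (M p)\<^sup>2) * M'' p a b) = 4 * M p ^ 5 + 48 * fst p * M p ^ 7"
      unfolding lorentz_trace_compose2 M(3-5)[OF p] by (simp add: lorentz_trace_def algebra_simps flip: power_Suc power_add)
    moreover have "0 \<le> 48 * fst p * M p ^ 7" using tp Mp by simp
    \<comment> \<open>A lower bound decreasing in t alone; on any set of bounded t it is at least a
      positive constant.\<close>
    moreover have "((fst p) ^ 4 + 16 * (fst p)\<^sup>2) powr (- 5 / 4) \<le> M p ^ 5"
    proof -
      have "lorentz_sq p - 4 \<le> (fst p)\<^sup>2" 
        using zero_le_power2[of "norm (snd p)"] unfolding lorentz_sq_def by linarith
      then have "(lorentz_sq p - 4)\<^sup>2 \<le> ((fst p)\<^sup>2)\<^sup>2" using tp by (intro power_mono) auto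
      then have "N p \<le> (fst p) ^ 4 + 16 * (fst p)\<^sup>2" by (simp add: N_def)
      then have "((fst p) ^ 4 + 16 * (fst p)\<^sup>2) powr (- 5 / 4) \<le> N p powr (- 5 / 4)"
        using Npos[OF p] by (intro powr_mono2') auto
      also have "\<dots> = M p ^ 5"
        using Npos[OF p] by (simp add: M_def powr_power)
      finally show ?thesis .
    qed
    ultimately show "4 * ((fst p) ^ 4 + 16 * (fst p)\<^sup>2) powr (- 5 / 4) \<le>
      lorentz_trace (\<lambda>a b. 0 * (fst a * fst b) + - 12 * (M p)\<^sup>2 * (fst a * M' p b + M' p a * fst b)
        + - 24 * fst p * M p * (M' p a * M' p b) + - 4 * M p ^ 3 * 0
        + (1 - 12 * fst p * (M p)\<^sup>2) * M'' p a b)"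
      by linarith
    \<comment> \<open>Since t^2 is at least q = s^2, (q - 4)^2 + 16 t^2 is at least (q + 4)^2, hence
      at least s^4.\<close>
    have "lorentz_sq p powr 2 \<le> N p"
    proof -
      have "lorentz_sq p \<le> (fst p)\<^sup>2" by (simp add: lorentz_sq_def)
      then have "(lorentz_sq p)\<^sup>2 \<le> N p"
        using tp unfolding N_def power2_diff by simp
      then show ?thesis using tp by simp
    qed
    then have "M p \<le> (lorentz_sq p powr 2) powr (- 1 / 4)"
      unfolding M_def using tp by (intro powr_mono2') auto
    also have "\<dots> = lorentz_sq p powr - (1 / 2)"
      by (subst powr_powr) simp
    also have "\<dots> = 1 / sqrt (lorentz_sq p)"
      using tp by (simp only: powr_minus_divide powr_half_sqrt)
    finally have "M p \<le> 1 / sqrt (lorentz_sq p)" .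
    moreover have "0 \<le> 4 * fst p * M p ^ 3" using tp Mp by simp
    ultimately show "M p - 4 * fst p * M p ^ 3 \<le> 1 / sqrt (lorentz_sq p)"
      by linarith
  qed
qed

section \<open>Extension by zero and reduction to zero Cauchy data\<close>

text \<open>Positivity is applied to a combination of the two supersolutions plus and minus
  \<open>w\<close>. The 4 compensates the 1/4 in the source of the first; \<open>m\<close> is
  divided by the least source that the second is known to have for t up to \<open>R\<close>.\<close>

lemma wave_bound:
  assumes C2: "C2_on (hyp_shell 2 b) w w' w''"
    and zero: "\<And>p. p \<in> hyp_shell 2 b \<Longrightarrow> lorentz_sq p = 2\<^sup>2 \<Longrightarrow> w p = 0"
    and zero': "\<And>p a. p \<in> hyp_shell 2 b \<Longrightarrow> lorentz_sq p = 2\<^sup>2 \<Longrightarrow> w' p a = 0"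
    and c: "0 \<le> c" "0 \<le> m" "0 < R"
    and source: "\<And>p. p \<in> hyp_shell 2 b \<Longrightarrow>
      \<bar>lorentz_trace (w'' p)\<bar> \<le> c / (fst p)\<^sup>2 + (if fst p \<le> R then m else 0)"
    and p: "p \<in> hyp_shell 2 b"
  shows "\<bar>w p\<bar> \<le> 4 * c * (sqrt (lorentz_sq p) / fst p)
    + m / (4 * (R ^ 4 + 16 * R\<^sup>2) powr (- 5 / 4)) / sqrt (lorentz_sq p)"
proof -
  define k where "k = 4 * (R ^ 4 + 16 * R\<^sup>2) powr (- 5 / 4)"
  have "0 < R ^ 4 + 16 * R\<^sup>2" using c by (intro add_pos_pos) auto
  then have "0 < k" by (simp add: k_def)
  obtain v v' v'' where v: "C2_on (hyp_shell 2 b) v v' v''"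
    "\<And>p. p \<in> hyp_shell 2 b \<Longrightarrow> lorentz_sq p = 2\<^sup>2 \<Longrightarrow> v p = 0"
    "\<And>p a. p \<in> hyp_shell 2 b \<Longrightarrow> lorentz_sq p = 2\<^sup>2 \<Longrightarrow> v' p a = 0"
    "\<And>p. p \<in> hyp_shell 2 b \<Longrightarrow> 1 / (4 * (fst p)\<^sup>2) \<le> lorentz_trace (v'' p)"
    "\<And>p. p \<in> hyp_shell 2 b \<Longrightarrow> v p \<le> sqrt (lorentz_sq p) / fst p"
    by (rule supersolution_inverse_square[of b]) blast
  obtain y y' y'' where y: "C2_on (hyp_shell 2 b) y y' y''"
    "\<And>p. p \<in> hyp_shell 2 b \<Longrightarrow> lorentz_sq p = 2\<^sup>2 \<Longrightarrow> y p = 0"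
    "\<And>p a. p \<in> hyp_shell 2 b \<Longrightarrow> lorentz_sq p = 2\<^sup>2 \<Longrightarrow> y' p a = 0"
    "\<And>p. p \<in> hyp_shell 2 b \<Longrightarrow>
      4 * ((fst p) ^ 4 + 16 * (fst p)\<^sup>2) powr (- 5 / 4) \<le> lorentz_trace (y'' p)"
    "\<And>p. p \<in> hyp_shell 2 b \<Longrightarrow> y p \<le> 1 / sqrt (lorentz_sq p)"
    by (rule supersolution_decaying[of b]) blast
  have tv: "c / (fst q)\<^sup>2 \<le> 4 * c * lorentz_trace (v'' q)" if "q \<in> hyp_shell 2 b" for q
    using mult_left_mono[OF v(4)[OF that], of "4 * c"] c by simp
  have ty: "(if fst q \<le> R then m else 0) \<le> m / k * lorentz_trace (y'' q)"
    if q: "q \<in> hyp_shell 2 b" for q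
  proof -
    have t: "0 < fst q" using q by (simp add: hyp_shell_def)
    have "0 \<le> lorentz_trace (y'' q)" using y(4)[OF q] by (rule order_trans[rotated]) simp
    moreover have "k \<le> lorentz_trace (y'' q)" if "fst q \<le> R"
    proof -
      have "(fst q) ^ 4 + 16 * (fst q)\<^sup>2 \<le> R ^ 4 + 16 * R\<^sup>2"
        using t that by (intro add_mono mult_left_mono power_mono) auto
      then have "k \<le> 4 * ((fst q) ^ 4 + 16 * (fst q)\<^sup>2) powr (- 5 / 4)"
        unfolding k_def using t by (intro mult_left_mono powr_mono2') (auto intro: add_pos_pos)
      then show ?thesis using y(4)[OF q] by linarith
    qed
    ultimately show ?thesis
      using c \<open>0 < k\<close> mult_left_mono[of k "lorentz_trace (y'' q)" "m / k"] by auto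
  qed
  have *: "0 \<le> 4 * c * v p + m / k * y p + e * w p" if e: "e = 1 \<or> e = - 1" for e
  proof (rule wave_positivity[OF _ C2_on_add[OF C2_on_add[OF C2_on_cmult[OF v(1)] C2_on_cmult[OF y(1)]]
            C2_on_cmult[OF C2]] _ _ _ p])
    show "4 * c * v q + m / k * y q + e * w q = 0"
      "4 * c * v' q a + m / k * y' q a + e * w' q a = 0"
      if "q \<in> hyp_shell 2 b" "lorentz_sq q = 2\<^sup>2" for q a
      using v(2,3) y(2,3) zero zero' that by simp_all
    show "0 \<le> lorentz_trace (\<lambda>a a'. 4 * c * v'' q a a' + m / k * y'' q a a' + e * w'' q a a')"
      if "q \<in> hyp_shell 2 b" for q
      unfolding lorentz_trace_linear using tv[OF that] ty[OF that] source[OF that] e by auto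
  qed simp
  have "\<bar>w p\<bar> \<le> 4 * c * v p + m / k * y p" using *[of 1] *[of "- 1"] by auto
  also have "\<dots> \<le> 4 * c * (sqrt (lorentz_sq p) / fst p) + m / k * (1 / sqrt (lorentz_sq p))"
    using v(5)[OF p] y(5)[OF p] c \<open>0 < k\<close> by (intro add_mono mult_left_mono) auto
  finally show ?thesis by (simp add: k_def)
qed

text \<open>\<open>C_diff_on\<close> controls iterated derivatives along basis vectors only. A
  derivative along general \<open>a\<close> is expanded in the basis before it is differentiated
  again, hence the sum in \<open>f''\<close>.\<close>

lemma C_diff_on_2_imp_C2_on:
  fixes f :: "'a::euclidean_space \<Rightarrow> real"
  assumes "C_diff_on 2 S f"
  shows "C2_on S f (\<lambda>p a. dir_deriv S a f p) (\<lambda>p a b. \<Sum>c\<in>Basis. (a \<bullet> c) * dir_deriv S b (dir_deriv S c f) p)"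
proof (rule C2_onI)
  have *: "f differentiable_on S" "\<And>v. v \<in> Basis \<Longrightarrow> dir_deriv S v f differentiable_on S"
    "\<And>v u. v \<in> Basis \<Longrightarrow> u \<in> Basis \<Longrightarrow> continuous_on S (dir_deriv S u (dir_deriv S v f))"
    using assms by (auto simp: numeral_2_eq_2)
  have der: "(g has_derivative (\<lambda>a. dir_deriv S a g p)) (at p within S)"
    if "g differentiable_on S" "p \<in> S" for g p
    using that unfolding dir_deriv_def differentiable_on_def
    by (auto simp: frechet_derivative_works[symmetric])
  then have expand: "dir_deriv S a g p = (\<Sum>c\<in>Basis. (a \<bullet> c) * dir_deriv S c g p)"
    if "g differentiable_on S" "p \<in> S" for a g p
    using linear_sum[OF has_derivative_linear[OF der[OF that]], of "\<lambda>c. (a \<bullet> c) *\<^sub>R c" Basis]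
      linear_scale[OF has_derivative_linear[OF der[OF that]]]
    by (simp add: euclidean_representation)
  show "(f has_derivative (\<lambda>a. dir_deriv S a f p)) (at p within S)" if "p \<in> S" for p
    using der * that by blast
  show "((\<lambda>q. dir_deriv S a f q) has_derivative
      (\<lambda>b. \<Sum>c\<in>Basis. (a \<bullet> c) * dir_deriv S b (dir_deriv S c f) p)) (at p within S)"
    if p: "p \<in> S" for p a
  proof (rule has_derivative_transform[OF p])
    show "((\<lambda>q. \<Sum>c\<in>Basis. (a \<bullet> c) * dir_deriv S c f q) has_derivative
      (\<lambda>b. \<Sum>c\<in>Basis. (a \<bullet> c) * dir_deriv S b (dir_deriv S c f) p)) (at p within S)"
      using der[OF *(2) p] by (intro has_derivative_sum has_derivative_mult_right) auto
  qed (rule expand[OF *(1)])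
  show "linear (\<lambda>a. \<Sum>c\<in>Basis. (a \<bullet> c) * dir_deriv S b (dir_deriv S c f) p)" for b p
    by (intro linearI) (simp_all add: inner_add_left algebra_simps sum.distrib sum_distrib_left)
  show "continuous_on S (\<lambda>p. \<Sum>c\<in>Basis. (a \<bullet> c) * dir_deriv S b (dir_deriv S c f) p)" for a b
  proof (intro continuous_on_sum continuous_on_mult_left)
    fix c :: 'a assume c: "c \<in> Basis"
    have "continuous_on S (\<lambda>p. \<Sum>d\<in>Basis. (b \<bullet> d) * dir_deriv S d (dir_deriv S c f) p)"
      using *(3)[OF c] by (intro continuous_on_sum continuous_on_mult_left) auto
    then show "continuous_on S (dir_deriv S b (dir_deriv S c f))"
      by (rule continuous_on_eq) (rule expand[OF *(2)[OF c], symmetric])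
  qed
qed

lemma basis_mem: "e_t \<in> Basis" "e_x i \<in> Basis"
  by (auto simp: e_t_def e_x_def Basis_prod_def)

lemma lorentz_trace_box_op:
  "lorentz_trace (\<lambda>a b. \<Sum>c\<in>Basis. (a \<bullet> c) * dir_deriv S b (dir_deriv S c u) p) = box_op S u p"
proof -
  have "(\<Sum>c\<in>Basis. (a \<bullet> c) * h c) = h a" if "a \<in> Basis" for a and h :: "spacetime \<Rightarrow> real"
    using that by (simp add: inner_Basis if_distrib[where f="\<lambda>x. x * h _"] cong: if_cong)
  then show ?thesis by (simp add: lorentz_trace_def box_op_def basis_mem)
qed

section \<open>Extension by zero\<close>

text \<open>In the interior this is uniqueness of derivatives. A boundary point is a limit of
  interior points of \<open>U\<close>, and the derivatives are continuous on
  \<open>S\<close>.\<close>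

lemma C2_on_vanishing:
  assumes C2: "C2_on S f f' f''" and S: "S \<subseteq> closure (interior S)"
    and U: "open U" and f: "\<And>q. q \<in> U \<inter> S \<Longrightarrow> f q = 0" and p: "p \<in> U \<inter> S"
  shows "f' p a = 0" "f'' p a b = 0"
proof -
  let ?I = "interior S \<inter> U"
  have I: "open ?I" "?I \<subseteq> S" using U interior_subset by auto
  have zero: "h' q a = 0"
    if "(h has_derivative h' q) (at q within S)" "\<And>r. r \<in> ?I \<Longrightarrow> h r = 0" "q \<in> ?I"
    for h :: "'a \<Rightarrow> real" and h' q a
  proof -
    have "(h has_derivative h' q) (at q)"
      using that(1) at_within_interior[of q S] that(3) by auto
    moreover have "(h has_derivative (\<lambda>_. 0)) (at q)"
      by (rule has_derivative_transform_within_open[of "\<lambda>_. 0" _ _ _ ?I]) (use that I in auto)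
    ultimately have "h' q = (\<lambda>_. 0)" by (rule has_derivative_unique)
    then show ?thesis by simp
  qed
  have f': "f' q a = 0" if "q \<in> ?I" for q a
    by (rule zero[where h=f]) (use that I C2_onD(1)[OF C2] f in auto)
  have f'': "f'' q a b = 0" if "q \<in> ?I" for q
    by (rule zero[where h="\<lambda>q. f' q a" and h'="\<lambda>q. f'' q a"]) (use that I C2_onD(2)[OF C2] f' in auto)
  have "p \<in> closure ?I"
    using open_Int_closure_subset[OF U, of "interior S"] p S by (auto simp: Int_commute)
  then have limit: "g p = 0" if g: "continuous_on S g" "\<And>q. q \<in> ?I \<Longrightarrow> g q = 0" for g :: "'a \<Rightarrow> real"
  proof -
    obtain T where T: "closed T" "{q \<in> S. g q = 0} = S \<inter> T"
      using continuous_closedin_preimage_constant[OF g(1), of 0] unfolding closedin_closed by blast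
    then have "?I \<subseteq> T" using g(2) I by auto
    then have "closure ?I \<subseteq> T" using T by (simp add: closure_minimal)
    then show ?thesis using T p \<open>p \<in> closure ?I\<close> by auto
  qed
  show "f' p a = 0" "f'' p a b = 0"
    using C2_onD(4,5)[OF C2] f' f'' by (auto intro: limit)
qed

text \<open>\<open>U\<close> bridges \<open>K\<close> and its exterior \<open>V\<close>: near any
  point of \<open>S\<close> outside \<open>K\<close> the extension is identically zero, and near a
  point of \<open>K\<close> it is \<open>f\<close>.\<close>

lemma C2_on_extend_zero:
  fixes f :: "'a::euclidean_space \<Rightarrow> real"
  assumes C2: "C2_on (S \<inter> K) f f' f''" and dense: "S \<inter> K \<subseteq> closure (interior (S \<inter> K))"
    and opens: "open K" "open U" "open V" and "V \<inter> K = {}" "S \<subseteq> K \<union> U \<union> V"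
    and f: "\<And>q. q \<in> U \<inter> (S \<inter> K) \<Longrightarrow> f q = 0"
  shows "C2_on S (\<lambda>p. if p \<in> K then f p else 0) (\<lambda>p a. if p \<in> K then f' p a else 0)
    (\<lambda>p a b. if p \<in> K then f'' p a b else 0)"
proof -
  note zero = C2_on_vanishing[OF C2 dense \<open>open U\<close> f]
  have der: "((\<lambda>p. if p \<in> K then h p else 0) has_derivative (\<lambda>b. if p \<in> K then h' p b else 0)) (at p within S)"
    if h: "\<And>p. p \<in> S \<inter> K \<Longrightarrow> (h has_derivative h' p) (at p within S \<inter> K)"
      "\<And>p. p \<in> U \<inter> (S \<inter> K) \<Longrightarrow> h p = 0" "\<And>p b. p \<in> U \<inter> (S \<inter> K) \<Longrightarrow> h' p b = 0"
      and p: "p \<in> S" for h :: "'a \<Rightarrow> real" and h' p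
  proof (cases "p \<in> K")
    case True
    have "at p within S = at p within S \<inter> K"
      by (rule at_within_nhd[OF True \<open>open K\<close>]) auto
    then have "(h has_derivative h' p) (at p within S)" using h(1) p True by auto
    then show ?thesis
      using True by (auto intro: has_derivative_transform_within_open[OF _ \<open>open K\<close> True])
  next
    case False
    then have "p \<in> U \<union> V" using p assms by auto
    moreover have "open (U \<union> V)" using opens by auto
    moreover have "((\<lambda>_. 0) has_derivative (\<lambda>_. 0)) (at p within S)" by simp
    ultimately have "((\<lambda>p. if p \<in> K then h p else 0) has_derivative (\<lambda>_. 0)) (at p within S)"
    proof (rule_tac has_derivative_transform_eventually[of "\<lambda>_. 0"])
      show "\<forall>\<^sub>F x in at p within S. 0 = (if x \<in> K then h x else 0)"
        unfolding eventually_at_topological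
        by (rule exI[of _ "U \<union> V"]) (use h(2) assms(6) \<open>p \<in> U \<union> V\<close> \<open>open (U \<union> V)\<close> in auto)
    qed (use False p in auto)
    then show ?thesis using False by simp
  qed
  have cont: "continuous_on S (\<lambda>p. if p \<in> K then g p else 0)"
    if "continuous_on (S \<inter> K) g" "\<And>p. p \<in> U \<inter> (S \<inter> K) \<Longrightarrow> g p = 0" for g :: "'a \<Rightarrow> real"
  proof -
    have S: "S = (S \<inter> K) \<union> (S \<inter> (U \<union> V))" using assms by auto
    have "continuous_on ((S \<inter> K) \<union> (S \<inter> (U \<union> V))) (\<lambda>p. if p \<in> K then g p else 0)"
    proof (rule continuous_on_Un_local_open)
      show "openin (top_of_set (S \<inter> K \<union> S \<inter> (U \<union> V))) (S \<inter> K)"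
        "openin (top_of_set (S \<inter> K \<union> S \<inter> (U \<union> V))) (S \<inter> (U \<union> V))"
        unfolding S[symmetric] using opens by (auto intro: openin_open_Int)
      show "continuous_on (S \<inter> K) (\<lambda>p. if p \<in> K then g p else 0)"
        using that(1) by (rule continuous_on_eq) auto
      show "continuous_on (S \<inter> (U \<union> V)) (\<lambda>p. if p \<in> K then g p else 0)"
        by (rule continuous_on_eq[of _ "\<lambda>_. 0"]) (use that(2) assms in auto)
    qed
    then show ?thesis using S by simp
  qed
  show ?thesis
  proof (rule C2_onI)
    show "((\<lambda>p. if p \<in> K then f p else 0) has_derivative (\<lambda>a. if p \<in> K then f' p a else 0)) (at p within S)"
      if "p \<in> S" for p
      by (rule der[OF C2_onD(1)[OF C2]]) (use f zero that in auto)
    show "((\<lambda>p. if p \<in> K then f' p a else 0) has_derivative (\<lambda>b. if p \<in> K then f'' p a b else 0)) (at p within S)"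
      if "p \<in> S" for p a
      by (rule der[where h="\<lambda>p. f' p a" and h'="\<lambda>p. f'' p a", OF C2_onD(2)[OF C2]]) (use zero that in auto)
    show "linear (\<lambda>a. if p \<in> K then f'' p a b else 0)" if "p \<in> S" for p b
    proof (cases "p \<in> K")
      case True
      then show ?thesis using C2_onD(3)[OF C2, of p b] that by simp
    qed (auto intro: linearI)
    show "continuous_on S (\<lambda>p. if p \<in> K then f'' p a b else 0)" for a b
      by (rule cont[OF C2_onD(4)[OF C2]]) (use zero in auto)
  qed
qed

lemma C2_on_snd:
  fixes f :: "'b::euclidean_space \<Rightarrow> real"
  assumes "C2_on UNIV f f' f''"
  shows "C2_on UNIV (\<lambda>p :: 'a::euclidean_space \<times> 'b. f (snd p)) (\<lambda>p a. f' (snd p) (snd a))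
    (\<lambda>p a b. f'' (snd p) (snd a) (snd b))"
proof (rule C2_onI)
  note D = C2_onD[OF assms]
  show "((\<lambda>p :: 'a \<times> 'b. f (snd p)) has_derivative (\<lambda>a. f' (snd p) (snd a))) (at p within UNIV)" for p
    by (rule has_derivative_compose[OF has_derivative_snd[OF has_derivative_ident] D(1)]) simp
  show "((\<lambda>p :: 'a \<times> 'b. f' (snd p) (snd a)) has_derivative (\<lambda>b. f'' (snd p) (snd a) (snd b))) (at p within UNIV)"
    for p and a :: "'a \<times> 'b"
    by (rule has_derivative_compose[OF has_derivative_snd[OF has_derivative_ident] D(2)]) simp
  show "linear (\<lambda>a :: 'a \<times> 'b. f'' (snd p) (snd a) (snd b))" for p b
    using D(3)[of "snd p" "snd b", THEN linear_add] D(3)[of "snd p" "snd b", THEN linear_scale]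
    by (intro linearI) simp_all
  show "continuous_on UNIV (\<lambda>p :: 'a \<times> 'b. f'' (snd p) (snd a) (snd b))" for a b
    by (intro continuous_on_compose2[OF D(4)] continuous_intros) auto
qed

section \<open>Extending the Cauchy data off the hyperboloid\<close>

lemma has_real_derivative_pos_part_power:
  "((\<lambda>x :: real. max 0 x ^ Suc (Suc n)) has_real_derivative real (Suc (Suc n)) * max 0 x ^ Suc n) (at x)"
proof -
  consider "x > 0" | "x < 0" | "x = 0" by linarith
  then show ?thesis
  proof cases
    case 1
    have "((\<lambda>x. x ^ Suc (Suc n)) has_real_derivative real (Suc (Suc n)) * x ^ Suc n) (at x)"
      using DERIV_pow[of "Suc (Suc n)" x] by simp
    then show ?thesis
      using 1 by (subst DERIV_cong_ev[OF refl _ refl, of _ "\<lambda>x. x ^ Suc (Suc n)"])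
        (auto intro!: eventually_mono[OF eventually_nhds_in_open[of "{0<..}" x]])
  next
    case 2
    then show ?thesis
      by (subst DERIV_cong_ev[OF refl _ refl, of _ "\<lambda>_. 0"])
        (auto intro!: eventually_mono[OF eventually_nhds_in_open[of "{..<0}" x]])
  next
    case 3
    have "((\<lambda>h :: real. \<bar>h\<bar> ^ Suc n) \<longlongrightarrow> \<bar>0\<bar> ^ Suc n) (at 0)"
      by (intro tendsto_intros)
    moreover have "norm (max 0 h ^ Suc (Suc n) / h) \<le> \<bar>h\<bar> ^ Suc n" for h :: real
    proof (cases "h > 0")
      case False
      then have "max 0 h = 0" by simp
      then show ?thesis by (simp only: power_0_Suc) (simp del: power_Suc)
    qed simp
    ultimately have "((\<lambda>h :: real. max 0 h ^ Suc (Suc n) / h) \<longlongrightarrow> 0) (at 0)"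
      by (rule_tac Lim_null_comparison[where g="\<lambda>h. \<bar>h\<bar> ^ Suc n"]) (simp_all del: power_Suc)
    then show ?thesis using 3 by (simp add: DERIV_def)
  qed
qed

text \<open>A function with prescribed Cauchy data \<open>U0\<close>, \<open>U1\<close> on \<open>s = 2\<close>, cut off in
  \<open>\<sigma> = t - (4 + |x|\<^sup>2)\<^sup>1\<^sup>/\<^sup>2\<close> by \<open>((1 - \<sigma>\<^sup>2)\<^sub>+)\<^sup>3\<close>, which is only \<open>C\<^sup>2\<close> but equals
  \<open>1 + O(\<sigma>\<^sup>2)\<close> at \<open>\<sigma> = 0\<close>.\<close>

lemma cauchy_data_extension:
  fixes U0 U1 :: "real ^ 2 \<Rightarrow> real"
  assumes U0: "C2_on UNIV U0 U0' U0''" and U1: "C2_on UNIV U1 U1' U1''"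
    and supp: "\<And>x. R < norm x \<Longrightarrow> U0 x = 0" "\<And>x. R < norm x \<Longrightarrow> U1 x = 0"
  obtains d d' d'' T where
    "C2_on UNIV d d' d''"
    "\<And>x. d (sqrt (4 + (norm x)\<^sup>2), x) = U0 x"
    "\<And>x. d' (sqrt (4 + (norm x)\<^sup>2), x) e_t = U1 x"
    "0 < T" "\<And>p. T < fst p \<Longrightarrow> d p = 0"
proof -
  define h :: "real ^ 2 \<Rightarrow> real" where "h = (\<lambda>x. sqrt (4 + x \<bullet> x))"
  have "C2_on UNIV (\<lambda>x :: real ^ 2. x \<bullet> x) (\<lambda>x a. 2 * (x \<bullet> a)) (\<lambda>_ a b. 2 * (b \<bullet> a))"
    by (intro C2_onI) (auto intro!: derivative_eq_intros linearI simp: inner_commute inner_add_right)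
  then have "\<exists>h' h''. C2_on UNIV h h' h''"
    unfolding h_def
  proof (intro exI, rule_tac C2_on_compose[where R="{0..}" and g="\<lambda>y. sqrt (4 + y)"
          and ?g1.0="\<lambda>y. 1 / (2 * sqrt (4 + y))" and ?g2.0="\<lambda>y. - 1 / (4 * (4 + y) * sqrt (4 + y))"])
    show "continuous_on {0..} (\<lambda>y. - 1 / (4 * (4 + y) * sqrt (4 + y)) :: real)"
      by (intro continuous_intros) auto
  qed (auto intro!: derivative_eq_intros simp: field_simps)
  then obtain h' h'' where h: "C2_on UNIV h h' h''" by blast
  define \<sigma> :: "spacetime \<Rightarrow> real" where "\<sigma> = (\<lambda>p. fst p + - 1 * h (snd p))"
  define \<sigma>' :: "spacetime \<Rightarrow> spacetime \<Rightarrow> real" where "\<sigma>' = (\<lambda>p a. fst a + - 1 * h' (snd p) (snd a))"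
  obtain \<sigma>'' where \<sigma>: "C2_on UNIV \<sigma> \<sigma>' \<sigma>''"
    unfolding \<sigma>_def \<sigma>'_def
    using C2_on_add[OF C2_on_linear[OF bounded_linear_fst] C2_on_cmult[OF C2_on_snd[OF h]]] by blast
  have r: "C2_on UNIV (\<lambda>p. 1 - (\<sigma> p)\<^sup>2) (\<lambda>p a. - 2 * \<sigma> p * \<sigma>' p a)
      (\<lambda>p a b. - 2 * (\<sigma>' p a * \<sigma>' p b) + - 2 * \<sigma> p * \<sigma>'' p a b)"
    by (rule C2_on_compose[OF \<sigma>, where R=UNIV and g="\<lambda>y. 1 - y\<^sup>2" and ?g1.0="\<lambda>y. - 2 * y"
          and ?g2.0="\<lambda>_. - 2"]) (auto intro!: derivative_eq_intros)
  define c where "c = (\<lambda>p. max 0 (1 - (\<sigma> p)\<^sup>2) ^ 3)"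
  define c' where "c' = (\<lambda>p a. 3 * max 0 (1 - (\<sigma> p)\<^sup>2) ^ 2 * (- 2 * \<sigma> p * \<sigma>' p a))"
  have "\<exists>c''. C2_on UNIV c c' c''"
    unfolding c_def c'_def
  proof (intro exI, rule C2_on_compose[OF r, where R=UNIV and g="\<lambda>y. max 0 y ^ 3"
        and ?g1.0="\<lambda>y. 3 * max 0 y ^ 2" and ?g2.0="\<lambda>y. 6 * max 0 y"])
    show "((\<lambda>y. max 0 y ^ 3) has_real_derivative 3 * max 0 x ^ 2) (at x)" for x :: real
      using has_real_derivative_pos_part_power[of 1 x] by (simp add: numeral_eq_Suc)
    show "((\<lambda>y. 3 * max 0 y ^ 2) has_real_derivative 6 * max 0 x) (at x)" for x :: real
      using DERIV_cmult[OF has_real_derivative_pos_part_power[of 0 x], of 3] by (simp add: numeral_2_eq_2)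
  qed (auto intro!: continuous_intros)
  then obtain c'' where c: "C2_on UNIV c c' c''" by blast
  \<comment> \<open>The function is (U0 + \<open>\<sigma>\<close> U1) c. At \<open>\<sigma>\<close>
    = 0 the cut-off \<open>c\<close> is 1 with zero differential, and \<open>\<sigma>\<close> has
    t-derivative 1, so value and t-derivative are the prescribed data.\<close>
  note d = C2_on_add[OF C2_on_mult[OF C2_on_snd[OF U0] c] C2_on_mult[OF C2_on_snd[OF U1] C2_on_mult[OF \<sigma> c]]]
  \<comment> \<open>The cut-off vanishes for \<open>\<sigma>\<close> above 1, and over the support
    of the data the hyperboloid lies at height at most \<open>sqrt (4 + R\<^sup>2)\<close>.\<close>
  define T where "T = 1 + sqrt (4 + R\<^sup>2)"
  show ?thesis
  proof (rule that[OF d])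
    fix x :: "real ^ 2"
    define p where "p = (sqrt (4 + (norm x)\<^sup>2), x)"
    have p: "\<sigma> p = 0" "c p = 1" "snd p = x"
      by (simp_all add: \<sigma>_def c_def h_def p_def power2_norm_eq_inner)
    have zero: "U0' x 0 = 0" "U1' x 0 = 0" "h' x 0 = 0"
      using C2_onD(7)[OF U0, of x, THEN linear_0] C2_onD(7)[OF U1, of x, THEN linear_0]
        C2_onD(7)[OF h, of x, THEN linear_0] by simp_all
    show "U0 (snd (sqrt (4 + (norm x)\<^sup>2), x)) * c (sqrt (4 + (norm x)\<^sup>2), x)
        + U1 (snd (sqrt (4 + (norm x)\<^sup>2), x)) * (\<sigma> (sqrt (4 + (norm x)\<^sup>2), x) * c (sqrt (4 + (norm x)\<^sup>2), x)) = U0 x"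
      unfolding p_def[symmetric] using p by simp
    show "c (sqrt (4 + (norm x)\<^sup>2), x) * U0' (snd (sqrt (4 + (norm x)\<^sup>2), x)) (snd e_t)
        + U0 (snd (sqrt (4 + (norm x)\<^sup>2), x)) * c' (sqrt (4 + (norm x)\<^sup>2), x) e_t
        + (\<sigma> (sqrt (4 + (norm x)\<^sup>2), x) * c (sqrt (4 + (norm x)\<^sup>2), x)
            * U1' (snd (sqrt (4 + (norm x)\<^sup>2), x)) (snd e_t)
          + U1 (snd (sqrt (4 + (norm x)\<^sup>2), x)) * (c (sqrt (4 + (norm x)\<^sup>2), x) * \<sigma>' (sqrt (4 + (norm x)\<^sup>2), x) e_t
            + \<sigma> (sqrt (4 + (norm x)\<^sup>2), x) * c' (sqrt (4 + (norm x)\<^sup>2), x) e_t)) = U1 x"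
      unfolding p_def[symmetric] using p zero by (simp add: c'_def \<sigma>'_def)
  next
    show "0 < T" unfolding T_def by (intro add_pos_nonneg) auto
    fix p :: spacetime assume T: "T < fst p"
    show "U0 (snd p) * c p + U1 (snd p) * (\<sigma> p * c p) = 0"
    proof (cases "R < norm (snd p)")
      case False
      then have "norm (snd p) \<le> \<bar>R\<bar>" by simp
      then have "h (snd p) \<le> sqrt (4 + R\<^sup>2)"
        unfolding h_def power2_norm_eq_inner[symmetric] by (simp add: abs_le_square_iff[symmetric])
      then have "1 < \<sigma> p" using T by (simp add: \<sigma>_def T_def)
      then have "1 - (\<sigma> p)\<^sup>2 < 0" by simp
      then have "c p = 0" by (simp add: c_def max_def)
      then show ?thesis by simp
    qed (simp add: supp)
  qed
qed

section \<open>Geometry of the slab\<close>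

lemma K_slab_eq: "K_slab 2 b = hyp_shell 2 b \<inter> K_cone"
proof -
  have iff: "sqrt (a\<^sup>2 + r\<^sup>2) \<le> t \<longleftrightarrow> a\<^sup>2 \<le> t\<^sup>2 - r\<^sup>2" "t \<le> sqrt (a\<^sup>2 + r\<^sup>2) \<longleftrightarrow> t\<^sup>2 - r\<^sup>2 \<le> a\<^sup>2"
    if "0 < t" for a r t :: real
  proof -
    have t: "t = sqrt (t\<^sup>2)" using that by simp
    have "sqrt (a\<^sup>2 + r\<^sup>2) \<le> t \<longleftrightarrow> a\<^sup>2 + r\<^sup>2 \<le> t\<^sup>2" "t \<le> sqrt (a\<^sup>2 + r\<^sup>2) \<longleftrightarrow> t\<^sup>2 \<le> a\<^sup>2 + r\<^sup>2"
      by (subst t, rule real_sqrt_le_iff)+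
    then show "sqrt (a\<^sup>2 + r\<^sup>2) \<le> t \<longleftrightarrow> a\<^sup>2 \<le> t\<^sup>2 - r\<^sup>2" "t \<le> sqrt (a\<^sup>2 + r\<^sup>2) \<longleftrightarrow> t\<^sup>2 - r\<^sup>2 \<le> a\<^sup>2"
      by (simp_all add: le_diff_eq diff_le_eq)
  qed
  have "(t, x) \<in> K_slab 2 b \<longleftrightarrow> (t, x) \<in> hyp_shell 2 b \<inter> K_cone" for t x
  proof (cases "(t, x) \<in> K_cone")
    case True
    then have "0 < t" using norm_ge_zero[of x] unfolding K_cone_def by (simp del: norm_ge_zero)
    then show ?thesis
      using True by (simp only: K_slab_def hyp_shell_def lorentz_sq_def mem_Collect_eq case_prod_conv Int_iff
          fst_conv snd_conv iff simp_thms)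
  qed (simp add: K_slab_def)
  then show ?thesis by auto
qed

lemma open_K_cone: "open K_cone"
proof -
  have *: "K_cone = {p. norm (snd p) + 1 < fst p}" by (auto simp: K_cone_def)
  show ?thesis unfolding * by (intro open_Collect_less continuous_intros)
qed

lemma lorentz_sq_scaleR: "lorentz_sq (c *\<^sub>R p) = c\<^sup>2 * lorentz_sq p"
  by (simp add: lorentz_sq_def power_mult_distrib right_diff_distrib)

text \<open>A point is scaled along its ray towards the middle hyperboloid s = (2 + b) / 2. This
  makes both bounds on s strict at once, and small scalings stay in the open cone.\<close>

lemma K_slab_subset_closure_interior:
  assumes "2 < b"
  shows "K_slab 2 b \<subseteq> closure (interior (K_slab 2 b))"
proof
  fix p assume p: "p \<in> K_slab 2 b"
  define I where "I = {p. 0 < fst p} \<inter> {p. 2\<^sup>2 < lorentz_sq p} \<inter> {p. lorentz_sq p < b\<^sup>2} \<inter> K_cone"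
  have "open I"
    unfolding I_def lorentz_sq_def by (intro open_Int open_Collect_less open_K_cone continuous_intros)
  moreover have "I \<subseteq> K_slab 2 b" by (auto simp: I_def K_slab_eq hyp_shell_def)
  ultimately have I: "I \<subseteq> interior (K_slab 2 b)" by (simp add: interior_maximal)
  define s where "s = sqrt (lorentz_sq p)"
  have ps: "p \<in> hyp_shell 2 b" "p \<in> K_cone" using p by (auto simp: K_slab_eq)
  have s: "2 \<le> s" "s\<^sup>2 = lorentz_sq p" using hyp_shell_bounds[OF ps(1)] by (auto simp: s_def)
  then have sb: "s \<le> b" using ps(1) assms by (rule_tac power2_le_imp_le) (auto simp: hyp_shell_def)
  define l where "l = (\<lambda>e. 1 + e * ((2 + b) / 2 - s) / s)"
  define q where "q = (\<lambda>e. l e *\<^sub>R p)"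
  have lim: "(q \<longlongrightarrow> p) (at_right 0)"
  proof -
    have "(q \<longlongrightarrow> (1 + 0 * ((2 + b) / 2 - s) / s) *\<^sub>R p) (at_right 0)"
      unfolding q_def l_def using s by (intro tendsto_intros) auto
    then show ?thesis by simp
  qed
  have "eventually (\<lambda>e. q e \<in> K_cone) (at_right 0)"
    using lim open_K_cone ps(2) by (rule topological_tendstoD)
  moreover have "eventually (\<lambda>e. e \<in> {0<..<1}) (at_right (0 :: real))"
    by (rule eventually_at_right_real) simp
  ultimately have "eventually (\<lambda>e. q e \<in> closure (interior (K_slab 2 b))) (at_right 0)"
  proof eventually_elim
    case (elim e)
    have ls: "l e * s = (1 - e) * s + e * ((2 + b) / 2)"
      using s by (simp add: l_def field_simps)
    have "(1 - e) * 2 + e * 2 < l e * s"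
      unfolding ls using elim s assms by (intro add_le_less_mono mult_left_mono mult_strict_left_mono) auto
    moreover have "l e * s < (1 - e) * b + e * b"
      unfolding ls using elim sb assms by (intro add_le_less_mono mult_left_mono mult_strict_left_mono) auto
    ultimately have l: "2 < l e * s" "l e * s < b" by (simp_all add: algebra_simps)
    then have "0 < l e * s" by simp
    then have "0 < l e" using s by (simp add: zero_less_mult_iff)
    have "lorentz_sq (q e) = (l e * s)\<^sup>2"
      using s by (simp add: q_def lorentz_sq_scaleR power_mult_distrib)
    moreover have "2\<^sup>2 < (l e * s)\<^sup>2" using l by (intro power_strict_mono) auto
    moreover have "(l e * s)\<^sup>2 < b\<^sup>2" using l by (intro power_strict_mono) auto
    moreover have "0 < fst (q e)" using \<open>0 < l e\<close> ps by (simp add: q_def hyp_shell_def)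
    ultimately have "q e \<in> I" using elim by (simp add: I_def)
    then show ?case using I closure_subset by blast
  qed
  then show "p \<in> closure (interior (K_slab 2 b))"
    by (intro Lim_in_closed_set[OF closed_closure _ _ lim]) auto
qed

lemma hyperboloid_data_support:
  assumes "Cc_inf_hyp 2 f" and "hyp_supp 2 f \<subseteq> K"
  obtains R f' f'' where "C2_on UNIV (\<lambda>x. f (sqrt (4 + (norm x)\<^sup>2), x)) f' f''"
    "\<And>x. R < norm x \<Longrightarrow> f (sqrt (4 + (norm x)\<^sup>2), x) = 0"
    "\<And>x. (sqrt (4 + (norm x)\<^sup>2), x) \<notin> K \<Longrightarrow> f (sqrt (4 + (norm x)\<^sup>2), x) = 0"
proof -
  have supp: "(sqrt (4 + (norm x)\<^sup>2), x) \<in> hyp_supp 2 f" if "f (sqrt (4 + (norm x)\<^sup>2), x) \<noteq> 0" for x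
    using that unfolding hyp_supp_def by (intro subsetD[OF closure_subset]) (simp add: hyperboloid_def)
  have "bounded (hyp_supp 2 f)" using assms(1) compact_imp_bounded by (auto simp: Cc_inf_hyp_def)
  then obtain R where R: "\<And>p. p \<in> hyp_supp 2 f \<Longrightarrow> norm p \<le> R" unfolding bounded_iff by blast
  have "C_diff_on 2 UNIV (\<lambda>x. f (sqrt (4 + (norm x)\<^sup>2), x))"
    using assms(1) by (auto simp: Cc_inf_hyp_def)
  then show ?thesis
  proof (rule that[OF C_diff_on_2_imp_C2_on])
    show "f (sqrt (4 + (norm x)\<^sup>2), x) = 0" if "R < norm x" for x
      using supp[of x] R[of "(sqrt (4 + (norm x)\<^sup>2), x)"] that norm_snd_le[of x "sqrt (4 + (norm x)\<^sup>2)"]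
      by fastforce
    show "f (sqrt (4 + (norm x)\<^sup>2), x) = 0" if "(sqrt (4 + (norm x)\<^sup>2), x) \<notin> K" for x
      using supp[of x] assms(2) that by blast
  qed
qed

text \<open>The difference of the extended \<open>u\<close> and \<open>d\<close> has zero Cauchy
  data, so \<open>wave_bound\<close> applies. Nothing in the resulting bound depends on
  \<open>b\<close>.\<close>

lemma wave_slab_bound:
  assumes b: "2 < b" and u: "C_diff_on 2 (K_slab 2 b) u" "vanishes_near_bdry (K_slab 2 b) u"
    and box: "\<And>p. p \<in> K_slab 2 b \<Longrightarrow> \<bar>box_op (K_slab 2 b) u p\<bar> \<le> c / (fst p)\<^sup>2"
    and data: "\<And>p. p \<in> hyperboloid 2 \<inter> K_cone \<Longrightarrow> u p = d p"
      "\<And>p. p \<in> hyperboloid 2 \<inter> K_cone \<Longrightarrow> dir_deriv (K_slab 2 b) e_t u p = d' p e_t"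
      "\<And>p. p \<in> hyperboloid 2 - K_cone \<Longrightarrow> d p = 0"
      "\<And>p. p \<in> hyperboloid 2 - K_cone \<Longrightarrow> d' p e_t = 0"
    and d: "C2_on UNIV d d' d''" "0 < T" "0 \<le> m"
      "\<And>p. p \<in> hyp_shell 2 b \<Longrightarrow> \<bar>lorentz_trace (d'' p)\<bar> \<le> (if fst p \<le> T then m else 0)"
    and p: "p \<in> K_slab 2 b"
  shows "\<bar>u p - d p\<bar> \<le> 4 * c * (sqrt (lorentz_sq p) / fst p)
    + m / (4 * (T ^ 4 + 16 * T\<^sup>2) powr (- 5 / 4)) / sqrt (lorentz_sq p)"
proof -
  let ?S = "hyp_shell 2 b" and ?D = "dir_deriv (K_slab 2 b)"
  let ?u' = "\<lambda>p a. if p \<in> K_cone then ?D a u p else 0"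
  let ?u'' = "\<lambda>p a b. if p \<in> K_cone then \<Sum>c\<in>Basis. (a \<bullet> c) * ?D b (?D c u) p else 0"
  obtain U where U: "open U" "K_bdry \<subseteq> U" "\<And>q. q \<in> U \<inter> K_slab 2 b \<Longrightarrow> u q = 0"
    using u(2) by (auto simp: vanishes_near_bdry_def)
  define V :: "spacetime set" where "V = {p. fst p < norm (snd p) + 1}"
  have "open V" unfolding V_def by (intro open_Collect_less continuous_intros)
  have uext: "C2_on ?S (\<lambda>p. if p \<in> K_cone then u p else 0) ?u' ?u''"
  proof (rule C2_on_extend_zero[OF _ _ open_K_cone U(1) \<open>open V\<close>])
    show "V \<inter> K_cone = {}" by (auto simp: V_def K_cone_def)
    show "?S \<subseteq> K_cone \<union> U \<union> V"
    proof
      fix q :: spacetime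
      consider "q \<in> K_cone" | "q \<in> K_bdry" | "q \<in> V"
        unfolding V_def K_cone_def K_bdry_def
        by (cases "fst q" "norm (snd q) + 1" rule: linorder_cases) (auto simp: split_def)
      then show "q \<in> K_cone \<union> U \<union> V" using U(2) by cases auto
    qed
  qed (use U(3) K_slab_subset_closure_interior[OF b] C_diff_on_2_imp_C2_on[OF u(1)] in
      \<open>simp_all flip: K_slab_eq\<close>)
  define w where "w = (\<lambda>p. (if p \<in> K_cone then u p else 0) + - 1 * d p)"
  define w' where "w' = (\<lambda>p a. ?u' p a + - 1 * d' p a)"
  define w'' where "w'' = (\<lambda>p a b. ?u'' p a b + - 1 * d'' p a b)"
  have w: "C2_on ?S w w' w''"
    unfolding w_def w'_def w''_def
    by (intro C2_on_add uext C2_on_cmult C2_on_subset[OF d(1)]) simp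
  \<comment> \<open>Evaluating the source bound at the given point of the slab forces its constant
    to be nonnegative.\<close>
  have c: "0 \<le> c"
  proof -
    have "0 < fst p" using p by (auto simp: K_slab_eq hyp_shell_def)
    moreover have "0 \<le> c / (fst p)\<^sup>2" using box[OF p] by linarith
    ultimately show ?thesis by (simp add: zero_le_divide_iff)
  qed
  have hyp: "q \<in> hyperboloid 2" "q = (sqrt (4 + (norm (snd q))\<^sup>2), snd q)"
    if "q \<in> ?S" "lorentz_sq q = 2\<^sup>2" for q
  proof -
    have "(fst q)\<^sup>2 = 4 + (norm (snd q))\<^sup>2" "0 < fst q"
      using that by (auto simp: hyp_shell_def lorentz_sq_def)
    then have "sqrt (4 + (norm (snd q))\<^sup>2) = fst q" by (intro real_sqrt_unique) auto
    then show "q \<in> hyperboloid 2" "q = (sqrt (4 + (norm (snd q))\<^sup>2), snd q)"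
      by (auto simp: hyperboloid_def prod_eq_iff split_def)
  qed
  have zero: "w q = 0" if "q \<in> ?S" "lorentz_sq q = 2\<^sup>2" for q
    using data(1,3)[of q] hyp(1)[OF that] by (simp add: w_def)
  have zero_t: "w' q e_t = 0" if "q \<in> ?S" "lorentz_sq q = 2\<^sup>2" for q
    using data(2,4)[of q] hyp(1)[OF that] by (simp add: w'_def)
  have shell: "(sqrt (4 + x \<bullet> x), x) \<in> ?S" "lorentz_sq (sqrt (4 + x \<bullet> x), x) = 2\<^sup>2" for x
  proof -
    have "0 < sqrt (4 + x \<bullet> x)" by (simp add: add_pos_nonneg)
    moreover show "lorentz_sq (sqrt (4 + x \<bullet> x), x) = 2\<^sup>2"
      by (simp add: lorentz_sq_def power2_norm_eq_inner)
    moreover have "2\<^sup>2 \<le> b\<^sup>2" using b by (intro power_mono) auto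
    ultimately show "(sqrt (4 + x \<bullet> x), x) \<in> ?S" by (simp add: hyp_shell_def)
  qed
  \<comment> \<open>A vector splits into a multiple of \<open>e_t\<close> and a tangent to the
    hyperboloid. The tangential derivative vanishes because \<open>w\<close> is zero along a curve
    in the hyperboloid, the other by \<open>zero_t\<close>.\<close>
  have zero': "w' q v = 0" if q: "q \<in> ?S" "lorentz_sq q = 2\<^sup>2" for q v
  proof -
    define g where "g = (\<lambda>e. (sqrt (4 + (snd q + e *\<^sub>R snd v) \<bullet> (snd q + e *\<^sub>R snd v)), snd q + e *\<^sub>R snd v))"
    define k where "k = (snd q \<bullet> snd v) / sqrt (4 + snd q \<bullet> snd q)"
    have g0: "g 0 = q" using hyp(2)[OF q] by (simp add: g_def power2_norm_eq_inner)
    have pos: "0 < 4 + snd q \<bullet> snd q" by (simp add: add_pos_nonneg)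
    have "((\<lambda>e. sqrt (4 + (snd q + e *\<^sub>R snd v) \<bullet> (snd q + e *\<^sub>R snd v))) has_real_derivative k) (at 0)"
      using pos unfolding k_def has_real_derivative_iff_has_vector_derivative has_vector_derivative_def
      by (auto intro!: derivative_eq_intros simp: inner_commute field_simps)
    then have g: "(g has_vector_derivative (k, snd v)) (at 0 within UNIV)"
      unfolding g_def
      by (intro has_vector_derivative_Pair) (auto intro!: derivative_eq_intros
          simp: has_real_derivative_iff_has_vector_derivative)
    have "g ` UNIV \<subseteq> ?S" using shell(1) by (auto simp: g_def)
    from C2_on_along(1)[OF w this UNIV_I g]
    have "((\<lambda>e. w (g e)) has_real_derivative w' q (k, snd v)) (at 0)" by (simp add: g0)
    moreover have "(\<lambda>e. w (g e)) = (\<lambda>_. 0)" using zero shell by (auto simp: g_def)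
    ultimately have "w' q (k, snd v) = 0" using DERIV_const DERIV_unique by metis
    moreover have "w' q v = w' q ((fst v - k) *\<^sub>R e_t + (k, snd v))"
      by (rule arg_cong[where f="w' q"]) (simp add: e_t_def prod_eq_iff)
    moreover have L: "linear (w' q)" using C2_onD(7)[OF w] q by blast
    ultimately show ?thesis using zero_t[OF q] by (simp add: linear_add[OF L] linear_scale[OF L])
  qed
  have source: "\<bar>lorentz_trace (w'' q)\<bar> \<le> c / (fst q)\<^sup>2 + (if fst q \<le> T then m else 0)"
    if q: "q \<in> ?S" for q
  proof -
    have "lorentz_trace (w'' q) = lorentz_trace (?u'' q) + - 1 * lorentz_trace (d'' q)"
      unfolding w''_def lorentz_trace_linear ..
    moreover have "\<bar>lorentz_trace (?u'' q)\<bar> \<le> c / (fst q)\<^sup>2"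
    proof (cases "q \<in> K_cone")
      case True
      then show ?thesis using box[of q] q by (simp add: lorentz_trace_box_op K_slab_eq)
    next
      case False
      then show ?thesis using c by (simp add: lorentz_trace_def)
    qed
    ultimately show ?thesis using d(4)[OF q] by linarith
  qed
  have "p \<in> ?S" "p \<in> K_cone" using p by (auto simp: K_slab_eq)
  then show ?thesis
    using wave_bound[OF w zero zero' c d(3,2) source \<open>p \<in> ?S\<close>] by (simp add: w_def)
qed

text \<open>The shell meets t at most \<open>T\<close> in a bounded set, where s is at most t and
  hence at most \<open>T\<close>; a bounded function is there at most a constant over s. The
  constants are uniform in \<open>b\<close>, so they can be fixed before the final
  hyperboloid.\<close>

lemma C2_on_compactly_supported_bounds:
  assumes d: "C2_on UNIV d d' d''" and T: "0 < T" "\<And>p. T < fst p \<Longrightarrow> d p = 0"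
  obtains k m where "0 \<le> k" "0 \<le> m"
    "\<And>b p. p \<in> hyp_shell 2 b \<Longrightarrow> \<bar>d p\<bar> \<le> k / sqrt (lorentz_sq p)"
    "\<And>b p. p \<in> hyp_shell 2 b \<Longrightarrow> \<bar>lorentz_trace (d'' p)\<bar> \<le> (if fst p \<le> T then m else 0)"
proof -
  define B :: "spacetime set" where "B = {0..T} \<times> cball 0 T"
  have "compact B" unfolding B_def by (intro compact_Times) auto
  have bounded: "\<exists>k\<ge>0. \<forall>p\<in>B. \<bar>g p\<bar> \<le> k" if "continuous_on UNIV g" for g :: "spacetime \<Rightarrow> real"
  proof -
    have "bounded (g ` B)"
      using that \<open>compact B\<close> by (intro compact_imp_bounded compact_continuous_image) (auto intro: continuous_on_subset)
    then show ?thesis unfolding bounded_pos by (auto intro: less_imp_le)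
  qed
  have "continuous_on UNIV (\<lambda>p. lorentz_trace (d'' p))"
    unfolding lorentz_trace_def by (intro continuous_intros C2_onD(4)[OF d])
  then obtain m where m: "0 \<le> m" "\<And>p. p \<in> B \<Longrightarrow> \<bar>lorentz_trace (d'' p)\<bar> \<le> m"
    using bounded by blast
  obtain k where k: "0 \<le> k" "\<And>p. p \<in> B \<Longrightarrow> \<bar>d p\<bar> \<le> k"
    using bounded[OF C2_onD(6)[OF d]] by blast
  have B: "p \<in> B" if "p \<in> hyp_shell 2 b" "fst p \<le> T" for b p
  proof -
    have "4 \<le> (fst p)\<^sup>2 - (norm (snd p))\<^sup>2" "0 < fst p"
      using that by (simp_all add: hyp_shell_def lorentz_sq_def)
    then have "norm (snd p) \<le> fst p"
      by (rule_tac power2_le_imp_le; linarith)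
    then show ?thesis using that \<open>0 < fst p\<close> by (auto simp: B_def mem_Times_iff)
  qed
  have tr0: "lorentz_trace (d'' p) = 0" if "T < fst p" for p
  proof -
    have "open {p :: spacetime. T < fst p}" by (intro open_Collect_less continuous_intros)
    then have "d'' p a b = 0" for a b
      using C2_on_vanishing(2)[OF d, of "{p. T < fst p}" p a b] T that by simp
    then show ?thesis by (simp add: lorentz_trace_def)
  qed
  show ?thesis
  proof (rule that[of "k * T" m])
    fix b p assume p: "p \<in> hyp_shell 2 b"
    show "\<bar>lorentz_trace (d'' p)\<bar> \<le> (if fst p \<le> T then m else 0)"
      using m(2)[OF B[OF p]] tr0[of p] by auto
    note s = hyp_shell_bounds[OF p]
    show "\<bar>d p\<bar> \<le> k * T / sqrt (lorentz_sq p)"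
    proof (cases "fst p \<le> T")
      case True
      then have "\<bar>d p\<bar> * sqrt (lorentz_sq p) \<le> k * T"
        using s(1,2) by (intro mult_mono k B[OF p True]) linarith+
      moreover have "0 < sqrt (lorentz_sq p)" using s(1) by linarith
      ultimately show ?thesis by (simp add: pos_le_divide_eq)
    next
      case False
      then show ?thesis using T k s by simp
    qed
  qed (use k m T in auto)
qed

theorem proposition4p1:
  shows "\<exists>C::real. C > 0 \<and>
    (\<forall>(u0 :: spacetime \<Rightarrow> real) (u1 :: spacetime \<Rightarrow> real).
      Cc_inf_hyp 2 u0 \<and> hyp_supp 2 u0 \<subseteq> hyperboloid 2 \<inter> K_cone \<and>
      Cc_inf_hyp 2 u1 \<and> hyp_supp 2 u1 \<subseteq> hyperboloid 2 \<inter> K_cone \<longrightarrow>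
      (\<exists>C0::real. \<forall>(s0::real) (u :: spacetime \<Rightarrow> real) (F :: spacetime \<Rightarrow> real) (CF::real).
        s0 > 2 \<and>
        C_diff_on 2 (K_slab 2 s0) u \<and>
        vanishes_near_bdry (K_slab 2 s0) u \<and>
        (\<forall>p\<in>K_slab 2 s0. box_op (K_slab 2 s0) u p = F p) \<and>
        (\<forall>p\<in>hyperboloid 2 \<inter> K_cone. u p = u0 p) \<and>
        (\<forall>p\<in>hyperboloid 2 \<inter> K_cone. dir_deriv (K_slab 2 s0) e_t u p = u1 p) \<and>
        vanishes_near_bdry (K_slab 2 s0) F \<and>
        (\<forall>(t, x)\<in>K_slab 2 s0. \<bar>F (t, x)\<bar> \<le> CF * t powi (-2)) \<longrightarrow>
        (\<forall>(t, x)\<in>K_slab 2 s0.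
          let s = sqrt (t\<^sup>2 - (norm x)\<^sup>2)
          in \<bar>u (t, x)\<bar> \<le> C * CF * (s / t) + C0 * inverse s)))"
\<comment> \<open>The 4 is the reciprocal of the constant 1/4 in the source of the first
  supersolution.\<close>
proof (rule exI[of _ 4], intro conjI allI impI)
  fix u0 u1 :: "spacetime \<Rightarrow> real"
  assume data: "Cc_inf_hyp 2 u0 \<and> hyp_supp 2 u0 \<subseteq> hyperboloid 2 \<inter> K_cone \<and>
    Cc_inf_hyp 2 u1 \<and> hyp_supp 2 u1 \<subseteq> hyperboloid 2 \<inter> K_cone"
  have D: "Cc_inf_hyp 2 u0" "hyp_supp 2 u0 \<subseteq> K_cone" "Cc_inf_hyp 2 u1" "hyp_supp 2 u1 \<subseteq> K_cone"
    using data by auto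
  obtain R0 U0' U0'' where U0: "C2_on UNIV (\<lambda>x. u0 (sqrt (4 + (norm x)\<^sup>2), x)) U0' U0''"
    "\<And>x. R0 < norm x \<Longrightarrow> u0 (sqrt (4 + (norm x)\<^sup>2), x) = 0"
    "\<And>x. (sqrt (4 + (norm x)\<^sup>2), x) \<notin> K_cone \<Longrightarrow> u0 (sqrt (4 + (norm x)\<^sup>2), x) = 0"
    by (rule hyperboloid_data_support[OF D(1,2)]) (rule that, assumption+)
  obtain R1 U1' U1'' where U1: "C2_on UNIV (\<lambda>x. u1 (sqrt (4 + (norm x)\<^sup>2), x)) U1' U1''"
    "\<And>x. R1 < norm x \<Longrightarrow> u1 (sqrt (4 + (norm x)\<^sup>2), x) = 0"
    "\<And>x. (sqrt (4 + (norm x)\<^sup>2), x) \<notin> K_cone \<Longrightarrow> u1 (sqrt (4 + (norm x)\<^sup>2), x) = 0"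
    by (rule hyperboloid_data_support[OF D(3,4)]) (rule that, assumption+)
  obtain d d' d'' T where d: "C2_on UNIV d d' d''"
    "\<And>x. d (sqrt (4 + (norm x)\<^sup>2), x) = u0 (sqrt (4 + (norm x)\<^sup>2), x)"
    "\<And>x. d' (sqrt (4 + (norm x)\<^sup>2), x) e_t = u1 (sqrt (4 + (norm x)\<^sup>2), x)"
    "0 < T" "\<And>p. T < fst p \<Longrightarrow> d p = 0"
    by (rule cauchy_data_extension[OF U0(1) U1(1), of "max R0 R1"]) (use U0(2) U1(2) in simp_all)
  have hyp: "\<exists>x. p = (sqrt (4 + (norm x)\<^sup>2), x)" if "p \<in> hyperboloid 2" for p
    using that by (auto simp: hyperboloid_def)
  have dd: "d p = u0 p" "d' p e_t = u1 p" "p \<notin> K_cone \<Longrightarrow> u0 p = 0" "p \<notin> K_cone \<Longrightarrow> u1 p = 0"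
    if "p \<in> hyperboloid 2" for p
    using hyp[OF that] d(2,3) U0(3) U1(3) by auto
  obtain k m where km: "0 \<le> k" "0 \<le> m"
    "\<And>b p. p \<in> hyp_shell 2 b \<Longrightarrow> \<bar>d p\<bar> \<le> k / sqrt (lorentz_sq p)"
    "\<And>b p. p \<in> hyp_shell 2 b \<Longrightarrow> \<bar>lorentz_trace (d'' p)\<bar> \<le> (if fst p \<le> T then m else 0)"
    using C2_on_compactly_supported_bounds[OF d(1,4,5)] by metis
  \<comment> \<open>The first summand bounds the part of \<open>u - d\<close> caused by the source
    of \<open>d\<close>, the second bounds \<open>d\<close> itself.\<close>
  define C0 where "C0 = m / (4 * (T ^ 4 + 16 * T\<^sup>2) powr (- 5 / 4)) + k"
  show "\<exists>C0::real. \<forall>(s0::real) (u :: spacetime \<Rightarrow> real) (F :: spacetime \<Rightarrow> real) (CF::real).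
        s0 > 2 \<and>
        C_diff_on 2 (K_slab 2 s0) u \<and>
        vanishes_near_bdry (K_slab 2 s0) u \<and>
        (\<forall>p\<in>K_slab 2 s0. box_op (K_slab 2 s0) u p = F p) \<and>
        (\<forall>p\<in>hyperboloid 2 \<inter> K_cone. u p = u0 p) \<and>
        (\<forall>p\<in>hyperboloid 2 \<inter> K_cone. dir_deriv (K_slab 2 s0) e_t u p = u1 p) \<and>
        vanishes_near_bdry (K_slab 2 s0) F \<and>
        (\<forall>(t, x)\<in>K_slab 2 s0. \<bar>F (t, x)\<bar> \<le> CF * t powi (-2)) \<longrightarrow>
        (\<forall>(t, x)\<in>K_slab 2 s0.
          let s = sqrt (t\<^sup>2 - (norm x)\<^sup>2)
          in \<bar>u (t, x)\<bar> \<le> 4 * CF * (s / t) + C0 * inverse s)"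
  proof (intro exI[of _ C0] allI impI ballI)
    fix s0 CF :: real and u F :: "spacetime \<Rightarrow> real" and z :: spacetime
    assume A: "s0 > 2 \<and>
        C_diff_on 2 (K_slab 2 s0) u \<and>
        vanishes_near_bdry (K_slab 2 s0) u \<and>
        (\<forall>p\<in>K_slab 2 s0. box_op (K_slab 2 s0) u p = F p) \<and>
        (\<forall>p\<in>hyperboloid 2 \<inter> K_cone. u p = u0 p) \<and>
        (\<forall>p\<in>hyperboloid 2 \<inter> K_cone. dir_deriv (K_slab 2 s0) e_t u p = u1 p) \<and>
        vanishes_near_bdry (K_slab 2 s0) F \<and>
        (\<forall>(t, x)\<in>K_slab 2 s0. \<bar>F (t, x)\<bar> \<le> CF * t powi (-2))"
      and z: "z \<in> K_slab 2 s0"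
    obtain t x where tx: "z = (t, x)" by (cases z)
    have box: "\<bar>box_op (K_slab 2 s0) u p\<bar> \<le> CF / (fst p)\<^sup>2" if "p \<in> K_slab 2 s0" for p
    proof -
      have "\<bar>F p\<bar> \<le> CF * fst p powi (- 2)" using A that by (cases p) auto
      also have "fst p powi (- 2) = inverse ((fst p)\<^sup>2)"
        by (simp add: power_int_def power_inverse)
      finally show ?thesis using A that by (simp add: divide_inverse)
    qed
    have "\<bar>u z - d z\<bar> \<le> 4 * CF * (sqrt (lorentz_sq z) / fst z)
        + m / (4 * (T ^ 4 + 16 * T\<^sup>2) powr (- 5 / 4)) / sqrt (lorentz_sq z)"
      by (rule wave_slab_bound[where d'=d', OF _ _ _ box _ _ _ _ d(1,4) km(2,4) z]) (use A dd in auto)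
    moreover have "\<bar>d z\<bar> \<le> k / sqrt (lorentz_sq z)"
      by (rule km(3)[of _ s0]) (use z in \<open>simp add: K_slab_eq\<close>)
    ultimately have "\<bar>u z\<bar> \<le> 4 * CF * (sqrt (lorentz_sq z) / fst z) + C0 / sqrt (lorentz_sq z)"
      unfolding C0_def add_divide_distrib by linarith
    then show "case z of (t, x) \<Rightarrow> let s = sqrt (t\<^sup>2 - (norm x)\<^sup>2)
        in \<bar>u (t, x)\<bar> \<le> 4 * CF * (s / t) + C0 * inverse s"
      by (simp add: tx lorentz_sq_def Let_def divide_inverse)
  qed
qed simp

end
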